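(* Fix $q\in(0,1)$, $\bar\rho\in(0,1)$, and $\eta>0$. There are a constant $\mu>0$, a constant $\gamma\in(0,1)$, and a sequence (indexed by the dimension $m$) of jointly Gaussian score vectors $(W_1,\ldots,W_m)$, each with a set of null and a set of nonnull coordinates, with the following properties: (1) every null score has the exact $N(0,1)$ distribution; (2) the fraction of nonnulls tends to $\gamma$, and every nonnull score has distribution $N(\mu,1)$; (3) every covariance matrix is positive definite and $\max_{i\ne j}|\operatorname{Corr}(W_i,W_j)|<\bar\rho$; (4) if $\mathrm{FDR}_m$ and $\mathrm{Power}_m$ denote the FDR and power of the knockoff+ threshold at nominal level $q$, then $$\liminf_{m\to\infty}\mathrm{FDR}_m>1-\eta,\qquad \liminf_{m\to\infty}\mathrm{Power}_m>1-\eta.$$ Moreover, with $\Phi$ the standard normal distribution function, the transformation $P_i=1-\Phi(W_i)$ gives exactly uniform null $p$-values, stochastically smaller nonnull $p$-values, and the same rejection sets under the mirror threshold at level $q$.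
   Context: Let $\mathcal H_0\subseteq\{1,\ldots,m\}$ be the set of true nulls and $\mathcal H_1$ its complement (nonnulls). For signed scores $W_1,\ldots,W_m$ and $t>0$, put $N_+(t)=\#\{i:W_i\ge t\}$, $N_-(t)=\#\{i:W_i\le -t\}$, and $\mathcal T=\{|W_i|:|W_i|>0\}$. The knockoff+ threshold at level $q$ is $$\widehat t=\min\Big\{t\in\mathcal T:\frac{1+N_-(t)}{N_+(t)\vee1}\le q\Big\},$$ with $\widehat t=\infty$ if the set is empty, and the rejection set is $\widehat{\mathcal R}=\{i:W_i\ge\widehat t\}$. For $p$-values $P_1,\ldots,P_m$ and $0<u\le1/2$, put $R(u)=\#\{i:P_i\le u\}$, $L(u)=\#\{i:P_i\ge1-u\}$, $\mathcal U=\{\min(P_i,1-P_i):1\le i\le m\}\cap(0,1/2]$; the mirror threshold at level $q$ is $\widehat u=\max\{u\in\mathcal U:(1+L(u))/(R(u)\vee1)\le q\}$, with $\widehat u=0$ if the set is empty, and it rejects $\{i:P_i\le\widehat u\}$. Here $a\vee b=\max\{a,b\}$. $\mathrm{FDR}=\mathbb E\{|\widehat{\mathcal R}\cap\mathcal H_0|/(|\widehat{\mathcal R}|\vee1)\}$ and $\mathrm{Power}=\mathbb E\{|\widehat{\mathcal R}\cap\mathcal H_1|/|\mathcal H_1|\}$. "Stochastically smaller" means stochastically smaller than the uniform distribution on $(0,1)$. *)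

theory Defs
  imports "HOL-Probability.Probability"
begin

abbreviation std_normal_cdf :: "real \<Rightarrow> real" ("\<Phi>") where
  "\<Phi> \<equiv> cdf std_normal_distribution"

text \<open>A univariate Gaussian variable; point masses count as Gaussians of variance zero.\<close>

definition gaussian_var :: "'a measure \<Rightarrow> ('a \<Rightarrow> real) \<Rightarrow> bool" where
  "gaussian_var M X \<longleftrightarrow> X \<in> borel_measurable M \<and>
     ((\<exists>c. AE \<omega> in M. X \<omega> = c) \<or>
      (\<exists>\<mu> \<sigma>. 0 < \<sigma> \<and> distributed M lborel X (\<lambda>x. ennreal (normal_density \<mu> \<sigma> x))))"

definition jointly_gaussian :: "'a measure \<Rightarrow> 'i set \<Rightarrow> ('i \<Rightarrow> 'a \<Rightarrow> real) \<Rightarrow> bool" where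
  "jointly_gaussian M I X \<longleftrightarrow>
     (\<forall>i\<in>I. X i \<in> borel_measurable M) \<and>
     (\<forall>a. gaussian_var M (\<lambda>\<omega>. \<Sum>i\<in>I. a i * X i \<omega>))"

definition covariance :: "'a measure \<Rightarrow> ('a \<Rightarrow> real) \<Rightarrow> ('a \<Rightarrow> real) \<Rightarrow> real" where
  "covariance M X Y =
     (\<integral>\<omega>. (X \<omega> - (\<integral>\<omega>'. X \<omega>' \<partial>M)) * (Y \<omega> - (\<integral>\<omega>'. Y \<omega>' \<partial>M)) \<partial>M)"

definition correlation :: "'a measure \<Rightarrow> ('a \<Rightarrow> real) \<Rightarrow> ('a \<Rightarrow> real) \<Rightarrow> real" where
  "correlation M X Y =
     covariance M X Y / (sqrt (covariance M X X) * sqrt (covariance M Y Y))"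

definition pos_def_on :: "'i set \<Rightarrow> ('i \<Rightarrow> 'i \<Rightarrow> real) \<Rightarrow> bool" where
  "pos_def_on I S \<longleftrightarrow>
     (\<forall>i\<in>I. \<forall>j\<in>I. S i j = S j i) \<and>
     (\<forall>a. (\<exists>i\<in>I. a i \<noteq> 0) \<longrightarrow> 0 < (\<Sum>i\<in>I. \<Sum>j\<in>I. a i * S i j * a j))"

text \<open>The usual (weak) stochastic order on laws: the smaller law has the pointwise larger
  distribution function.\<close>

definition stoch_smaller :: "real measure \<Rightarrow> real measure \<Rightarrow> bool" where
  "stoch_smaller M N \<longleftrightarrow> (\<forall>x. cdf N x \<le> cdf M x)"

text \<open>Coordinates are \<open>1, \<dots>, m\<close>; the values of \<^term>\<open>w\<close> and \<^term>\<open>p\<close> elsewhere are irrelevant.\<close>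

definition N_plus :: "nat \<Rightarrow> (nat \<Rightarrow> real) \<Rightarrow> real \<Rightarrow> nat" where
  "N_plus m w t = card {i\<in>{1..m}. w i \<ge> t}"

definition N_minus :: "nat \<Rightarrow> (nat \<Rightarrow> real) \<Rightarrow> real \<Rightarrow> nat" where
  "N_minus m w t = card {i\<in>{1..m}. w i \<le> - t}"

definition knockoff_candidates :: "nat \<Rightarrow> (nat \<Rightarrow> real) \<Rightarrow> real set" where
  "knockoff_candidates m w = {\<bar>w i\<bar> | i. i \<in> {1..m} \<and> \<bar>w i\<bar> > 0}"

definition knockoff_threshold :: "real \<Rightarrow> nat \<Rightarrow> (nat \<Rightarrow> real) \<Rightarrow> ereal" where
  "knockoff_threshold q m w =
     (let A = {t \<in> knockoff_candidates m w.
                 (1 + real (N_minus m w t)) / real (max (N_plus m w t) 1) \<le> q}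
      in if A = {} then \<infinity> else ereal (Min A))"

definition knockoff_rejections :: "real \<Rightarrow> nat \<Rightarrow> (nat \<Rightarrow> real) \<Rightarrow> nat set" where
  "knockoff_rejections q m w = {i\<in>{1..m}. ereal (w i) \<ge> knockoff_threshold q m w}"

definition R_count :: "nat \<Rightarrow> (nat \<Rightarrow> real) \<Rightarrow> real \<Rightarrow> nat" where
  "R_count m p u = card {i\<in>{1..m}. p i \<le> u}"

definition L_count :: "nat \<Rightarrow> (nat \<Rightarrow> real) \<Rightarrow> real \<Rightarrow> nat" where
  "L_count m p u = card {i\<in>{1..m}. p i \<ge> 1 - u}"

definition mirror_candidates :: "nat \<Rightarrow> (nat \<Rightarrow> real) \<Rightarrow> real set" where
  "mirror_candidates m p = (\<lambda>i. min (p i) (1 - p i)) ` {1..m} \<inter> {0<..1/2}"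

definition mirror_threshold :: "real \<Rightarrow> nat \<Rightarrow> (nat \<Rightarrow> real) \<Rightarrow> real" where
  "mirror_threshold q m p =
     (let A = {u \<in> mirror_candidates m p.
                 (1 + real (L_count m p u)) / real (max (R_count m p u) 1) \<le> q}
      in if A = {} then 0 else Max A)"

definition mirror_rejections :: "real \<Rightarrow> nat \<Rightarrow> (nat \<Rightarrow> real) \<Rightarrow> nat set" where
  "mirror_rejections q m p = {i\<in>{1..m}. p i \<le> mirror_threshold q m p}"

definition FDR :: "'a measure \<Rightarrow> ('a \<Rightarrow> nat set) \<Rightarrow> nat set \<Rightarrow> real" where
  "FDR M R H0 = (\<integral>\<omega>. real (card (R \<omega> \<inter> H0)) / real (max (card (R \<omega>)) 1) \<partial>M)"

text \<open>If \<^term>\<open>H1\<close> is empty, the power is \<open>0\<close> by the convention for division by zero.\<close>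

definition Power :: "'a measure \<Rightarrow> ('a \<Rightarrow> nat set) \<Rightarrow> nat set \<Rightarrow> real" where
  "Power M R H1 = (\<integral>\<omega>. real (card (R \<omega> \<inter> H1)) / real (card H1) \<partial>M)"

end

theory Submission
  imports Defs "HOL-Real_Asymp.Real_Asymp"
begin

text \<open>
  Scores driven by a single Gaussian factor \<open>Z\<close> do it. Most nulls form a large block
  \<open>c Z + sqrt (1 - c\<^sup>2) \<epsilon>\<^sub>i\<close>, and a small fraction \<open>\<beta>\<close> of the scores forms
  a null block \<open>- b Z + sqrt (1 - b\<^sup>2) \<epsilon>\<^sub>i\<close> with \<open>0 < b < c\<close>; a far smaller fraction
  \<open>\<gamma>\<close> consists of independent \<open>N(\<mu>, 1)\<close> nonnulls. If \<open>Z \<ge> \<delta>\<close>, the large block is shifted to the right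
  and dominates at a moderate level \<open>t\<^sub>1\<close>, where the ratio of its two tails is below \<open>q\<close>.
  If \<open>Z \<le> - \<delta>\<close>, the small block is shifted to the right; it has the larger idiosyncratic
  variance, so at a sufficiently high level \<open>t\<^sub>2\<close> it dominates both tails in spite of its size.
  Hence, unless \<open>\<bar>Z\<bar>\<close> is atypical, the procedure stops at or below \<open>t\<^sub>1\<close> or \<open>t\<^sub>2\<close> and rejects a number of
  nulls that is of order \<open>m\<close> and much larger than \<open>\<gamma> m\<close>; a large \<open>\<mu>\<close> gives the power. As all counts
  are monotone in \<open>Z\<close>, they are bounded by counts at the fixed values \<open>\<plusminus>\<delta>\<close> and \<open>-B\<close> of \<open>Z\<close>, so the law of
  large numbers is needed for the noise \<open>\<epsilon>\<^sub>i\<close> only, without conditioning on \<open>Z\<close>.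
\<close>

section \<open>The standard normal distribution\<close>

abbreviation gauss :: "real measure" where "gauss \<equiv> std_normal_distribution"

interpretation gauss: real_distribution gauss
  by (rule real_dist_normal_dist)

text \<open>The half-line is closed to match the non-strict inequalities in \<open>N_plus\<close>
  and \<open>N_minus\<close>.\<close>

definition upper_tail :: "real \<Rightarrow> real" where
  "upper_tail x = measure gauss {x..}"

lemma gauss_singleton: "measure gauss {x} = 0"
proof -
  have "emeasure gauss {x} = (\<integral>\<^sup>+y. ennreal (std_normal_density y) * indicator {x} y \<partial>lborel)"
    by (subst emeasure_density) auto
  also have "\<dots> = (\<integral>\<^sup>+(y::real). 0 \<partial>lborel)"
    by (intro nn_integral_cong_AE eventually_mono[OF AE_lborel_singleton[of x]]) auto
  finally show ?thesis by (simp add: measure_def)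
qed

lemma upper_tail_eq: "upper_tail x = 1 - \<Phi> x"
proof -
  have "1 - measure gauss {..<x} = upper_tail x"
    unfolding upper_tail_def
    by (subst gauss.prob_compl[symmetric]) (auto intro!: arg_cong[where f="measure gauss"])
  moreover have "\<Phi> x = measure gauss {..<x}"
  proof -
    have "\<Phi> x = measure gauss ({..<x} \<union> {x})"
      unfolding cdf_def by (rule arg_cong[where f="measure gauss"]) auto
    also have "\<dots> = measure gauss {..<x} + measure gauss {x}"
      by (rule gauss.finite_measure_Union) auto
    finally show ?thesis using gauss_singleton by simp
  qed
  ultimately show ?thesis by simp
qed

lemma distr_gauss_uminus: "distr gauss borel uminus = gauss"
proof -
  have "distributed gauss lborel (\<lambda>x. x) std_normal_density"
    by (auto simp: distributed_def distr_id2 intro!: distr_id2)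
  then have "distributed gauss lborel (\<lambda>x. 0 + (-1) * x) (normal_density (0 + (-1) * 0) (\<bar>-1\<bar> * 1))"
    by (rule gauss.normal_density_affine) auto
  then show ?thesis
    by (simp add: distributed_def cong: distr_cong)
qed

lemma measure_gauss_atMost: "measure gauss {..x} = upper_tail (- x)"
proof -
  have "measure (distr gauss borel uminus) {..x} = measure gauss (uminus -` {..x} \<inter> space gauss)"
    by (rule measure_distr) auto
  also have "uminus -` {..x} \<inter> space gauss = {-x..}" by auto
  finally show ?thesis by (simp add: distr_gauss_uminus upper_tail_def)
qed

lemma cdf_gauss_uminus: "\<Phi> (- x) = 1 - \<Phi> x"
  using measure_gauss_atMost[of "-x"] by (simp add: cdf_def upper_tail_eq)

text \<open>The density is positive everywhere, so a nondegenerate interval of Gaussian measure zero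
  would be Lebesgue null.\<close>

lemma cdf_gauss_strict_mono: "strict_mono \<Phi>"
proof (rule strict_monoI)
  fix x y :: real assume "x < y"
  have "measure gauss {x<..y} \<noteq> 0"
  proof
    assume "measure gauss {x<..y} = 0"
    then have "emeasure gauss {x<..y} = 0"
      by (simp add: gauss.emeasure_eq_measure)
    then have "AE z in lborel. z \<notin> {x<..y}"
      by (subst (asm) emeasure_density, simp, simp, subst (asm) nn_integral_0_iff_AE)
         (auto simp: indicator_def normal_density_pos[THEN less_imp_neq, symmetric] elim!: eventually_mono split: if_splits)
    then have "emeasure lborel {x<..y} = 0"
      by (subst (asm) AE_iff_measurable[where N="{x<..y}"]) auto
    with \<open>x < y\<close> show False by simp
  qed
  then have "0 < measure gauss {x<..y}" using measure_nonneg[of gauss "{x<..y}"] by linarith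
  with gauss.cdf_diff_eq[OF \<open>x < y\<close>] show "\<Phi> x < \<Phi> y" by simp
qed

lemma cdf_gauss_less_iff [simp]: "\<Phi> x < \<Phi> y \<longleftrightarrow> x < y"
  and cdf_gauss_le_iff [simp]: "\<Phi> x \<le> \<Phi> y \<longleftrightarrow> x \<le> y"
  using cdf_gauss_strict_mono by (simp_all add: strict_mono_less strict_mono_less_eq)

lemma borel_measurable_cdf_gauss [measurable]: "\<Phi> \<in> borel_measurable borel"
  by (rule borel_measurable_mono) (simp add: mono_def)

lemma cdf_gauss_0: "\<Phi> 0 = 1 / 2"
  using cdf_gauss_uminus[of 0] by simp

lemma isCont_cdf_gauss: "isCont \<Phi> x"
  by (simp add: gauss.isCont_cdf gauss_singleton)

lemma cdf_gauss_pos: "0 < \<Phi> x"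
  using cdf_gauss_less_iff[of "x - 1" x] gauss.cdf_nonneg[of "x - 1"] by linarith

lemma cdf_gauss_less_1: "\<Phi> x < 1"
  using cdf_gauss_pos[of "-x"] by (simp add: cdf_gauss_uminus)

lemma upper_tail_pos: "0 < upper_tail x"
  and upper_tail_less_1: "upper_tail x < 1"
  using cdf_gauss_pos cdf_gauss_less_1 by (simp_all add: upper_tail_eq)

text \<open>Shifting by \<open>d\<close> multiplies the density at \<open>x\<close> by
  \<open>exp (- d * x - d\<^sup>2 / 2)\<close>, which is at most \<open>exp (- (d * y))\<close> for
  \<open>x \<ge> y\<close>; integrate over \<open>{y..}\<close>. All later comparisons of tails rest
  on this bound.\<close>

lemma upper_tail_shift:
  assumes "0 \<le> d"
  shows "upper_tail (y + d) \<le> exp (- (d * y)) * upper_tail y"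
proof -
  have "ennreal (upper_tail (y + d)) = (\<integral>\<^sup>+x. ennreal (std_normal_density x) * indicator {y+d..} x \<partial>lborel)"
    unfolding upper_tail_def gauss.emeasure_eq_measure[symmetric] by (subst emeasure_density) auto
  also have "\<dots> = (\<integral>\<^sup>+x. ennreal (std_normal_density (d + 1 * x)) * indicator {y+d..} (d + 1 * x) \<partial>lborel)"
    by (subst nn_integral_real_affine[where c=1 and t=d]) auto
  also have "\<dots> \<le> (\<integral>\<^sup>+x. ennreal (exp (- (d * y))) * (ennreal (std_normal_density x) * indicator {y..} x) \<partial>lborel)"
  proof (rule nn_integral_mono)
    fix x :: real
    show "ennreal (std_normal_density (d + 1 * x)) * indicator {y+d..} (d + 1 * x)
      \<le> ennreal (exp (- (d * y))) * (ennreal (std_normal_density x) * indicator {y..} x)"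
    proof (cases "y \<le> x")
      case True
      have "d * y \<le> d * x" using assms True by (rule mult_left_mono[rotated])
      then have "- ((d + x)\<^sup>2 / 2) \<le> - (d * y) - x\<^sup>2 / 2"
        by (simp add: power2_eq_square field_simps) (use zero_le_square[of d] in linarith)
      then have "std_normal_density (d + x) \<le> exp (- (d * y)) * std_normal_density x"
        unfolding std_normal_density_def
        by (simp add: divide_right_mono mult_exp_exp)
      with True show ?thesis by (simp add: ennreal_mult'[symmetric] ennreal_leI)
    qed auto
  qed
  also have "\<dots> = ennreal (exp (- (d * y))) * emeasure gauss {y..}"
    by (subst nn_integral_cmult) (auto simp: emeasure_density)
  also have "\<dots> = ennreal (exp (- (d * y)) * upper_tail y)"
    unfolding upper_tail_def gauss.emeasure_eq_measure by (simp add: ennreal_mult')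
  finally show ?thesis
    using upper_tail_pos[of y] by (subst (asm) ennreal_le_iff) (auto intro: less_imp_le)
qed

text \<open>Distribution functions are compared pointwise. For \<open>u\<close> strictly between 0
  and 1 the event \<open>1 - \<Phi> x \<le> u\<close> is a half-line starting at the quantile
  \<open>x0\<close> of order \<open>1 - u\<close>.\<close>

lemma distr_one_minus_cdf_gauss:
  "distr gauss borel (\<lambda>x. 1 - \<Phi> x) = uniform_measure lborel {0<..<1}"
proof -
  have U: "prob_space (uniform_measure lborel {0<..<1::real})"
    by (rule prob_space_uniform_measure) auto
  interpret U: real_distribution "uniform_measure lborel {0<..<1::real}"
    using U by (auto simp: real_distribution_def real_distribution_axioms_def)
  have D: "real_distribution (distr gauss borel (\<lambda>x. 1 - \<Phi> x))"
    by (rule gauss.real_distribution_distr) measurable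
  have "cdf (distr gauss borel (\<lambda>x. 1 - \<Phi> x)) u = cdf (uniform_measure lborel {0<..<1}) u" for u
  proof -
    have L: "cdf (distr gauss borel (\<lambda>x. 1 - \<Phi> x)) u = measure gauss {x. 1 - \<Phi> x \<le> u}"
      unfolding cdf_def[of "distr _ _ _"]
      by (subst measure_distr) (auto intro!: arg_cong[where f="measure gauss"])
    have R: "cdf (uniform_measure lborel {0<..<1}) u = measure lborel ({0<..<1} \<inter> {..u})"
      unfolding cdf_def by (subst measure_uniform_measure) auto
    consider "u \<le> 0" | "1 \<le> u" | "0 < u" "u < 1" by linarith
    then show ?thesis
    proof cases
      case 1
      then have "{x. 1 - \<Phi> x \<le> u} = {}" "{0<..<1} \<inter> {..u} = {}"
        using cdf_gauss_less_1 by (auto simp: not_le) (smt (verit))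
      then show ?thesis by (simp only: L R measure_empty)
    next
      case 2
      then have "{x. 1 - \<Phi> x \<le> u} = UNIV" "{0<..<1} \<inter> {..u} = {0<..<1}"
        using cdf_gauss_pos by auto (smt (verit))
      then show ?thesis using gauss.prob_space by (simp add: L R)
    next
      case 3
      \<comment> \<open>The limits of \<Phi> at both infinities bracket \<open>1 - u\<close>, and
        continuity supplies the quantile.\<close>
      have "\<exists>x. \<Phi> x = 1 - u"
      proof -
        have "\<forall>\<^sub>F x in at_top. 1 - u < \<Phi> x" "\<forall>\<^sub>F x in at_bot. \<Phi> x < 1 - u"
          using 3 order_tendstoD(1)[OF gauss.cdf_lim_at_top_prob, of "1 - u"]
            order_tendstoD(2)[OF gauss.cdf_lim_at_bot, of "1 - u"] by auto
        then obtain a b where "1 - u < \<Phi> b" "\<Phi> a < 1 - u"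
          by (meson eventually_happens trivial_limit_at_bot_linorder trivial_limit_at_top_linorder)
        moreover from this have "a \<le> b"
          by (metis cdf_gauss_less_iff less_trans less_imp_le)
        ultimately show ?thesis
          using IVT[of \<Phi> a "1 - u" b] isCont_cdf_gauss by (auto simp: less_imp_le)
      qed
      then obtain x0 where x0: "\<Phi> x0 = 1 - u" ..
      have "(1 - \<Phi> x \<le> u) = (x0 \<le> x)" for x
        using x0 cdf_gauss_le_iff[of x0 x] by linarith
      then have "{x. 1 - \<Phi> x \<le> u} = {x0..}" by auto
      then have "cdf (distr gauss borel (\<lambda>x. 1 - \<Phi> x)) u = u"
        using upper_tail_eq[of x0] x0 by (simp add: L upper_tail_def)
      moreover have "{0<..<1} \<inter> {..u} = {0<..u}" using 3 by auto
      ultimately show ?thesis using 3 by (simp add: R)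
    qed
  qed
  then show ?thesis
    by (intro cdf_unique D U.real_distribution_axioms ext)
qed

section \<open>Rejection sets\<close>

text \<open>A finite minimum lies below \<open>x\<close> iff some member does, and the default
  \<infinity> corresponds to an empty existential. This removes \<open>Min\<close> and
  \<open>ereal\<close> and leaves finitely many conditions on the scores, which also makes
  measurability accessible.\<close>

lemma knockoff_rejections_iff:
  "i \<in> knockoff_rejections q m w \<longleftrightarrow> i \<in> {1..m} \<and>
     (\<exists>j\<in>{1..m}. w j \<noteq> 0 \<and>
        (1 + real (N_minus m w \<bar>w j\<bar>)) / real (max (N_plus m w \<bar>w j\<bar>) 1) \<le> q \<and> \<bar>w j\<bar> \<le> w i)"
proof -
  define A where "A = {t \<in> knockoff_candidates m w.
                 (1 + real (N_minus m w t)) / real (max (N_plus m w t) 1) \<le> q}"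
  have "finite A" unfolding A_def knockoff_candidates_def by auto
  have "knockoff_threshold q m w = (if A = {} then \<infinity> else ereal (Min A))"
    by (simp add: knockoff_threshold_def A_def Let_def)
  then have "knockoff_threshold q m w \<le> ereal x \<longleftrightarrow> (\<exists>t\<in>A. t \<le> x)" for x
    using \<open>finite A\<close> by (cases "A = {}") (auto simp: Min_le_iff)
  then show ?thesis
    unfolding knockoff_rejections_def A_def knockoff_candidates_def by (auto simp del: One_nat_def) blast+
qed

text \<open>For p-values inside the open unit interval every \<open>min (p j) (1 - p j)\<close> is a
  candidate, and \<open>p i > 0\<close> keeps the default threshold 0 from rejecting
  anything.\<close>

lemma mirror_rejections_iff:
  assumes "\<And>j. j \<in> {1..m} \<Longrightarrow> 0 < p j \<and> p j < 1"
  shows "i \<in> mirror_rejections q m p \<longleftrightarrow> i \<in> {1..m} \<and>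
     (\<exists>j\<in>{1..m}. (1 + real (L_count m p (min (p j) (1 - p j))))
          / real (max (R_count m p (min (p j) (1 - p j))) 1) \<le> q \<and> p i \<le> min (p j) (1 - p j))"
proof -
  define A where "A = {u \<in> mirror_candidates m p.
                 (1 + real (L_count m p u)) / real (max (R_count m p u) 1) \<le> q}"
  have c: "mirror_candidates m p = (\<lambda>i. min (p i) (1 - p i)) ` {1..m}"
    unfolding mirror_candidates_def using assms by (auto simp: min_def)
  have "finite A" unfolding A_def c by auto
  have "mirror_threshold q m p = (if A = {} then 0 else Max A)"
    unfolding mirror_threshold_def A_def[symmetric] Let_def ..
  then have "x \<le> mirror_threshold q m p \<longleftrightarrow> (\<exists>u\<in>A. x \<le> u)" if "0 < x" for x
    using \<open>finite A\<close> that by (cases "A = {}") (auto simp: Max_ge_iff)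
  then show ?thesis
    unfolding mirror_rejections_def using assms by (auto simp: A_def c)
qed

text \<open>By symmetry of the normal law the strictly decreasing map \<open>1 - \<Phi>\<close>
  sends \<open>\<bar>w j\<bar>\<close> to \<open>min (p j) (1 - p j)\<close> and carries
  \<open>N_plus\<close> and \<open>N_minus\<close> to \<open>R_count\<close> and
  \<open>L_count\<close>, so the two existential descriptions agree term by term.\<close>

lemma mirror_rejections_eq_knockoff_rejections:
  assumes nz: "\<And>i. i \<in> {1..m} \<Longrightarrow> w i \<noteq> 0"
  shows "mirror_rejections q m (\<lambda>i. 1 - \<Phi> (w i)) = knockoff_rejections q m w"
proof -
  have u: "min (1 - \<Phi> x) (1 - (1 - \<Phi> x)) = 1 - \<Phi> \<bar>x\<bar>" for x
    using cdf_gauss_le_iff[of 0 x] cdf_gauss_le_iff[of x 0]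
    by (auto simp: cdf_gauss_0 cdf_gauss_uminus min_def abs_if)
  have le: "1 - \<Phi> x \<le> 1 - \<Phi> y \<longleftrightarrow> y \<le> x" for x y by simp
  have ge: "1 - (1 - \<Phi> t) \<le> 1 - \<Phi> x \<longleftrightarrow> x \<le> - t" for x t
    using cdf_gauss_le_iff[of x "-t"] by (simp add: cdf_gauss_uminus del: cdf_gauss_le_iff) linarith
  have R: "R_count m (\<lambda>i. 1 - \<Phi> (w i)) (1 - \<Phi> t) = N_plus m w t" for t
    unfolding R_count_def N_plus_def le ..
  have L: "L_count m (\<lambda>i. 1 - \<Phi> (w i)) (1 - \<Phi> t) = N_minus m w t" for t
    unfolding L_count_def N_minus_def ge ..
  show ?thesis
  proof (rule set_eqI)
    fix i
    have "i \<in> mirror_rejections q m (\<lambda>i. 1 - \<Phi> (w i)) \<longleftrightarrow> i \<in> {1..m} \<and>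
      (\<exists>j\<in>{1..m}. (1 + real (N_minus m w \<bar>w j\<bar>)) / real (max (N_plus m w \<bar>w j\<bar>) 1) \<le> q
        \<and> \<bar>w j\<bar> \<le> w i)"
      by (subst mirror_rejections_iff) (simp_all only: u R L le, simp add: cdf_gauss_pos cdf_gauss_less_1)
    then show "i \<in> mirror_rejections q m (\<lambda>i. 1 - \<Phi> (w i)) \<longleftrightarrow> i \<in> knockoff_rejections q m w"
      unfolding knockoff_rejections_iff using nz by blast
  qed
qed

text \<open>This allows testing a deterministic level that need not be a candidate: raising
  \<open>t\<close> to the smallest \<open>\<bar>w j\<bar>\<close> above it crosses no score, so both
  counts stay the same, and that value is a candidate.\<close>

lemma knockoff_rejections_superset:
  assumes "0 < t" "1 \<le> N_plus m w t" "1 + real (N_minus m w t) \<le> q * real (N_plus m w t)"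
  shows "{i\<in>{1..m}. t \<le> w i} \<subseteq> knockoff_rejections q m w"
proof -
  define A where "A = {i\<in>{1..m}. t \<le> \<bar>w i\<bar>}"
  have P: "{i\<in>{1..m}. t \<le> w i} \<noteq> {}"
    using assms(2) unfolding N_plus_def by (metis card.empty not_one_le_zero)
  then have A: "finite A" "A \<noteq> {}" unfolding A_def by fastforce+
  define j where "j = arg_min_on (\<lambda>i. \<bar>w i\<bar>) A"
  have j: "j \<in> A" "\<And>i. i \<in> A \<Longrightarrow> \<bar>w j\<bar> \<le> \<bar>w i\<bar>"
    unfolding j_def using arg_min_if_finite[OF A, of "\<lambda>i. \<bar>w i\<bar>"] arg_min_least[OF A] by auto
  have tj: "t \<le> \<bar>w j\<bar>" using j(1) by (auto simp: A_def)
  have "\<bar>w j\<bar> \<le> w i \<longleftrightarrow> t \<le> w i" if "i \<in> {1..m}" for i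
    using that j(2)[of i] tj \<open>0 < t\<close> by (auto simp: A_def)
  then have ge: "{i\<in>{1..m}. \<bar>w j\<bar> \<le> w i} = {i\<in>{1..m}. t \<le> w i}" by blast
  have "w i \<le> - \<bar>w j\<bar> \<longleftrightarrow> w i \<le> - t" if "i \<in> {1..m}" for i
    using that j(2)[of i] tj \<open>0 < t\<close> by (auto simp: A_def)
  then have le: "{i\<in>{1..m}. w i \<le> - \<bar>w j\<bar>} = {i\<in>{1..m}. w i \<le> - t}" by blast
  have N: "N_plus m w \<bar>w j\<bar> = N_plus m w t" "N_minus m w \<bar>w j\<bar> = N_minus m w t"
    unfolding N_plus_def N_minus_def ge le by simp_all
  have "(1 + real (N_minus m w \<bar>w j\<bar>)) / real (max (N_plus m w \<bar>w j\<bar>) 1) \<le> q"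
    unfolding N using assms(2,3) by (simp add: max_def divide_le_eq)
  moreover have "j \<in> {1..m}" "w j \<noteq> 0" using j(1) tj \<open>0 < t\<close> by (auto simp: A_def)
  ultimately show ?thesis
    using ge unfolding knockoff_rejections_iff subset_iff by blast
qed

section \<open>Independent Gaussian noise\<close>

text \<open>A single infinite product carries the scores of every dimension, so the probability
  space does not change with \<open>m\<close>.\<close>

abbreviation noise :: "(nat \<Rightarrow> real) measure" where
  "noise \<equiv> PiM UNIV (\<lambda>_. gauss)"

interpretation noise: prob_space noise
  by (intro prob_space_PiM gauss.prob_space_axioms)

lemma measurable_noise_component [measurable]: "(\<lambda>\<omega>. \<omega> i) \<in> borel_measurable noise"
proof -
  have "(\<lambda>\<omega>. \<omega> i) \<in> measurable noise gauss" by measurable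
  then show ?thesis by simp
qed

lemma distr_noise_component: "distr noise borel (\<lambda>\<omega>. \<omega> i) = gauss"
proof -
  have "distr noise borel (\<lambda>\<omega>. \<omega> i) = distr noise gauss (\<lambda>\<omega>. \<omega> i)"
    by (rule distr_cong) auto
  also have "\<dots> = gauss"
    by (rule distr_PiM_component[OF gauss.prob_space_axioms]) simp
  finally show ?thesis .
qed

lemma distributed_noise_component:
  "distributed noise lborel (\<lambda>\<omega>. \<omega> i) (\<lambda>x. ennreal (std_normal_density x))"
proof -
  have "distr noise lborel (\<lambda>\<omega>. \<omega> i) = distr noise borel (\<lambda>\<omega>. \<omega> i)"
    by (rule distr_cong) auto
  then show ?thesis
    by (auto simp: distributed_def distr_noise_component)
qed

lemma indep_vars_noise: "noise.indep_vars (\<lambda>_. borel) (\<lambda>i \<omega>. \<omega> i) I"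
proof -
  have "distr noise (\<Pi>\<^sub>M i\<in>UNIV. borel) (\<lambda>x. \<lambda>i\<in>UNIV. x i) = distr noise noise (\<lambda>x. x)"
    by (rule distr_cong) (auto intro!: sets_PiM_cong)
  also have "\<dots> = (\<Pi>\<^sub>M i\<in>UNIV. distr noise borel (\<lambda>\<omega>. \<omega> i))"
    by (simp add: distr_noise_component)
  finally have "noise.indep_vars (\<lambda>_. borel) (\<lambda>i \<omega>. \<omega> i) UNIV"
    by (subst noise.indep_vars_iff_distr_eq_PiM) auto
  then show ?thesis by (rule noise.indep_vars_subset) simp
qed

lemma distributed_linear_noise:
  fixes k :: "nat \<Rightarrow> real"
  assumes "finite I" and "\<exists>i\<in>I. k i \<noteq> 0"
  shows "distributed noise lborel (\<lambda>\<omega>. c + (\<Sum>i\<in>I. k i * \<omega> i))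
           (\<lambda>x. ennreal (normal_density c (sqrt (\<Sum>i\<in>I. (k i)\<^sup>2)) x))"
proof -
  \<comment> \<open>Zero coefficients are dropped: their terms are constants without a density,
    while the summation rule for independent normals needs positive standard deviations.\<close>
  define J where "J = {i\<in>I. k i \<noteq> 0}"
  have J: "finite J" "J \<noteq> {}" using assms by (auto simp: J_def)
  have sums: "(\<Sum>i\<in>J. k i * \<omega> i) = (\<Sum>i\<in>I. k i * \<omega> i)" "(\<Sum>i\<in>J. \<bar>k i\<bar>\<^sup>2) = (\<Sum>i\<in>I. (k i)\<^sup>2)" for \<omega>
    using assms(1) by (auto simp: J_def intro!: sum.mono_neutral_left)
  have "distributed noise lborel (\<lambda>\<omega>. 0 + k i * \<omega> i) (normal_density (0 + k i * 0) (\<bar>k i\<bar> * 1))" if "i \<in> J" for i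
    using that by (intro noise.normal_density_affine distributed_noise_component) (auto simp: J_def)
  moreover have "noise.indep_vars (\<lambda>_. borel) (\<lambda>i \<omega>. k i * \<omega> i) J"
    by (rule noise.indep_vars_compose2[OF indep_vars_noise]) auto
  ultimately have "distributed noise lborel (\<lambda>\<omega>. \<Sum>i\<in>J. k i * \<omega> i)
      (normal_density (\<Sum>i\<in>J. 0) (sqrt (\<Sum>i\<in>J. \<bar>k i\<bar>\<^sup>2)))"
    using J by (intro noise.sum_indep_normal) (auto simp: J_def)
  moreover have "0 < (\<Sum>i\<in>J. \<bar>k i\<bar>\<^sup>2)"
    using J by (intro sum_pos) (auto simp: J_def)
  ultimately have "distributed noise lborel (\<lambda>\<omega>. c + 1 * (\<Sum>i\<in>J. k i * \<omega> i))
      (normal_density (c + 1 * (\<Sum>i\<in>J. 0)) (\<bar>1\<bar> * sqrt (\<Sum>i\<in>J. \<bar>k i\<bar>\<^sup>2)))"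
    by (intro noise.normal_density_affine) auto
  then show ?thesis unfolding sums by simp
qed

lemma noise_first_moment: "has_bochner_integral noise (\<lambda>\<omega>. \<omega> i) 0"
proof -
  have "integrable noise (\<lambda>\<omega>. \<omega> i)"
    using integrable_std_normal_moment[of 1]
    by (subst distributed_integrable[OF distributed_noise_component, of "\<lambda>x. x", symmetric]) auto
  moreover have "noise.expectation (\<lambda>\<omega>. \<omega> i) = 0"
    by (rule noise.standard_normal_distributed_expectation[OF distributed_noise_component])
  ultimately show ?thesis by (simp add: has_bochner_integral_iff)
qed

lemma noise_second_moment:
  "has_bochner_integral noise (\<lambda>\<omega>. \<omega> i * \<omega> j) (if i = j then 1 else 0)"
proof -
  have int: "integrable noise (\<lambda>\<omega>. \<omega> i)" and E: "noise.expectation (\<lambda>\<omega>. \<omega> i) = 0" for i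
    using noise_first_moment by (auto simp: has_bochner_integral_iff)
  show ?thesis
  proof (cases "i = j")
    case True
    have "integrable noise (\<lambda>\<omega>. (\<omega> i)\<^sup>2)"
      using integrable_std_normal_moment[of 2]
      by (subst distributed_integrable[OF distributed_noise_component, of "\<lambda>x. x\<^sup>2", symmetric]) auto
    moreover have "noise.expectation (\<lambda>\<omega>. (\<omega> i)\<^sup>2) = 1"
      using noise.standard_normal_distributed_variance[OF distributed_noise_component[of i]] by (simp add: E)
    ultimately show ?thesis using True by (simp add: has_bochner_integral_iff power2_eq_square)
  next
    case False
    have "integrable noise (\<lambda>\<omega>. \<Prod>k\<in>{i,j}. \<omega> k)"
      by (rule noise.indep_vars_integrable) (auto intro: indep_vars_noise int)
    moreover have "noise.expectation (\<lambda>\<omega>. \<Prod>k\<in>{i,j}. \<omega> k) = (\<Prod>k\<in>{i,j}. noise.expectation (\<lambda>\<omega>. \<omega> k))"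
      by (rule noise.indep_vars_lebesgue_integral) (auto intro: indep_vars_noise int)
    ultimately show ?thesis using False by (simp add: has_bochner_integral_iff E)
  qed
qed

lemma covariance_linear_noise:
  fixes f g :: "nat \<Rightarrow> real"
  assumes "finite I"
  shows "covariance noise (\<lambda>\<omega>. c + (\<Sum>i\<in>I. f i * \<omega> i)) (\<lambda>\<omega>. d + (\<Sum>i\<in>I. g i * \<omega> i))
       = (\<Sum>i\<in>I. f i * g i)"
proof -
  have "has_bochner_integral noise (\<lambda>\<omega>. c + (\<Sum>i\<in>I. f i * \<omega> i)) (c + (\<Sum>i\<in>I. f i * 0))"
    for c and f :: "nat \<Rightarrow> real"
    by (intro has_bochner_integral_add has_bochner_integral_sum has_bochner_integral_mult_right
          noise_first_moment) (simp add: has_bochner_integral_iff noise.prob_space)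
  then have E: "noise.expectation (\<lambda>\<omega>. c + (\<Sum>i\<in>I. f i * \<omega> i)) = c" for c and f :: "nat \<Rightarrow> real"
    by (simp add: has_bochner_integral_iff)
  have "has_bochner_integral noise (\<lambda>\<omega>. \<Sum>i\<in>I. \<Sum>j\<in>I. (f i * g j) * (\<omega> i * \<omega> j))
          (\<Sum>i\<in>I. \<Sum>j\<in>I. (f i * g j) * (if i = j then 1 else 0))"
    by (intro has_bochner_integral_sum has_bochner_integral_mult_right noise_second_moment)
  also have "(\<lambda>\<omega>. \<Sum>i\<in>I. \<Sum>j\<in>I. (f i * g j) * (\<omega> i * \<omega> j))
      = (\<lambda>\<omega>. (\<Sum>i\<in>I. f i * \<omega> i) * (\<Sum>i\<in>I. g i * \<omega> i))"
    by (simp add: sum_product mult_ac)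
  also have "(\<Sum>i\<in>I. \<Sum>j\<in>I. (f i * g j) * (if i = j then 1 else 0)) = (\<Sum>i\<in>I. f i * g i)"
    using assms by (intro sum.cong) (auto simp: if_distrib sum.delta cong: if_cong)
  finally show ?thesis
    unfolding covariance_def E by (simp add: has_bochner_integral_iff)
qed

text \<open>A weak law of large numbers for blocks of varying size. Half of \<epsilon> absorbs the
  deviation of the block fraction from \<kappa>, the other half is handled by Hoeffding's
  inequality. Errors are measured relative to \<open>m\<close>, not to the block size.\<close>

lemma noise_count_tendsto:
  fixes I :: "nat \<Rightarrow> nat set"
  assumes S: "S \<in> sets borel" and fin: "\<And>m. I m \<subseteq> {1..m}"
    and dens: "(\<lambda>m. real (card (I m)) / real m) \<longlonglongrightarrow> \<kappa>" and "0 < \<epsilon>"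
  shows "(\<lambda>m. noise.prob {\<omega>\<in>space noise.
      \<epsilon> * real m \<le> \<bar>real (card {i\<in>I m. \<omega> i \<in> S}) - \<kappa> * measure gauss S * real m\<bar>}) \<longlonglongrightarrow> 0"
proof -
  define p where "p = measure gauss S"
  have p: "0 \<le> p" "p \<le> 1" by (auto simp: p_def)
  have "\<forall>\<^sub>F m in sequentially. noise.prob {\<omega>\<in>space noise.
      \<epsilon> * real m \<le> \<bar>real (card {i\<in>I m. \<omega> i \<in> S}) - \<kappa> * p * real m\<bar>} \<le> 2 * exp (- (\<epsilon>\<^sup>2 / 2) * real m)"
  proof -
    have "\<forall>\<^sub>F m in sequentially. dist (real (card (I m)) / real m) \<kappa> < \<epsilon> / 2"
      using dens \<open>0 < \<epsilon>\<close> by (intro tendstoD) auto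
    then show ?thesis
      using eventually_gt_at_top[of 0]
    proof eventually_elim
      case (elim m)
      define n where "n = card (I m)"
      have I: "finite (I m)" "n \<le> m"
        using fin[of m] finite_subset card_mono[OF _ fin[of m]] by (auto simp: n_def)
      have cnt: "real (card {i\<in>I m. \<omega> i \<in> S}) = (\<Sum>i\<in>I m. indicator S (\<omega> i))" for \<omega> :: "nat \<Rightarrow> real"
        using I(1) by (simp add: indicator_def sum.If_cases Int_def)
      have "\<bar>real n / real m - \<kappa>\<bar> * (real m * p) \<le> (\<epsilon> / 2) * (real m * 1)"
        using elim p \<open>0 < \<epsilon>\<close> by (intro mult_mono) (auto simp: dist_real_def n_def)
      moreover have "\<bar>real n / real m - \<kappa>\<bar> * (real m * p) = \<bar>(real n / real m - \<kappa>) * (real m * p)\<bar>"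
        using p by (simp add: abs_mult)
      moreover have "(real n / real m - \<kappa>) * (real m * p) = real n * p - \<kappa> * p * real m"
        using elim by (simp add: field_simps)
      ultimately have near: "\<bar>real n * p - \<kappa> * p * real m\<bar> \<le> \<epsilon> / 2 * real m" by simp
      have sub: "{\<omega>\<in>space noise. \<epsilon> * real m \<le> \<bar>real (card {i\<in>I m. \<omega> i \<in> S}) - \<kappa> * p * real m\<bar>}
          \<subseteq> {\<omega>\<in>space noise. \<epsilon> / 2 * real m \<le> \<bar>(\<Sum>i\<in>I m. indicator S (\<omega> i)) - real n * p\<bar>}"
        unfolding cnt
      proof (intro Collect_mono impI conjI; elim conjE)
        fix \<omega>
        assume "\<epsilon> * real m \<le> \<bar>(\<Sum>i\<in>I m. indicator S (\<omega> i)) - \<kappa> * p * real m\<bar>"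
        with near show "\<epsilon> / 2 * real m \<le> \<bar>(\<Sum>i\<in>I m. indicator S (\<omega> i)) - real n * p\<bar>"
          by linarith
      qed
      show ?case
      \<comment> \<open>Hoeffding's inequality is applied to a nonempty block; for an empty one the
        deviation event is itself empty.\<close>
      proof (cases "I m = {}")
        case True
        have "\<not> \<epsilon> / 2 * real m \<le> 0" using elim \<open>0 < \<epsilon>\<close> by (simp add: not_le)
        then have "{\<omega>\<in>space noise. \<epsilon> * real m \<le> \<bar>real (card {i\<in>I m. \<omega> i \<in> S}) - \<kappa> * p * real m\<bar>} = {}"
          using sub True by (auto simp: n_def)
        then show ?thesis by (simp only: measure_empty) simp
      next
        case False
        have distr: "distr noise borel (\<lambda>\<omega>. indicator S (\<omega> i)) = distr noise borel (\<lambda>\<omega>. indicator S (\<omega> 0) :: real)" for i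
        proof -
          have "distr noise borel (\<lambda>\<omega>. indicator S (\<omega> i) :: real) = distr (distr noise borel (\<lambda>\<omega>. \<omega> i)) borel (indicator S)" for i
            using S by (subst distr_distr) (auto simp: comp_def)
          then show ?thesis by (simp add: distr_noise_component)
        qed
        have E: "noise.expectation (\<lambda>\<omega>. indicator S (\<omega> 0)) = p"
        proof -
          have "p = integral\<^sup>L (distr noise borel (\<lambda>\<omega>. \<omega> 0)) (indicator S)"
            using S unfolding distr_noise_component p_def by simp
          also have "\<dots> = noise.expectation (\<lambda>\<omega>. indicator S (\<omega> 0))"
            using S by (subst integral_distr) auto
          finally show ?thesis ..
        qed
        \<comment> \<open>Coordinate 0 only serves as the reference variable for the common
          law.\<close>
        interpret H: Hoeffding_ineq_iid noise "I m" "\<lambda>i \<omega>. indicator S (\<omega> i)" "\<lambda>\<omega>. indicator S (\<omega> 0)" 0 1 p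
        proof unfold_locales
          show "noise.indep_vars (\<lambda>_. borel) (\<lambda>i \<omega>. indicator S (\<omega> i) :: real) (I m)"
            using S by (intro noise.indep_vars_compose2[OF indep_vars_noise]) auto
          show "distr noise borel (\<lambda>\<omega>. indicator S (\<omega> i) :: real) = distr noise borel (\<lambda>\<omega>. indicator S (\<omega> 0))" for i
            by (rule distr)
          show "finite (I m)" by (rule I)
          show "noise.random_variable borel (\<lambda>\<omega>. indicator S (\<omega> 0) :: real)"
            using S by measurable
          show "p \<equiv> noise.expectation (\<lambda>\<omega>. indicator S (\<omega> 0))"
            by (rule eq_reflection) (rule E[symmetric])
        qed (simp_all add: indicator_def)
        have "noise.prob {\<omega>\<in>space noise. \<epsilon> * real m \<le> \<bar>real (card {i\<in>I m. \<omega> i \<in> S}) - \<kappa> * p * real m\<bar>}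
          \<le> noise.prob {\<omega>\<in>space noise. \<epsilon> / 2 * real m \<le> \<bar>(\<Sum>i\<in>I m. indicator S (\<omega> i)) - real n * p\<bar>}"
          using S by (intro noise.finite_measure_mono sub) measurable
        also have "\<dots> \<le> 2 * exp (-2 * (\<epsilon> / 2 * real m)\<^sup>2 / (real n * (1 - 0)\<^sup>2))"
          unfolding n_def using \<open>0 < \<epsilon>\<close> False by (intro H.Hoeffding_ineq_abs_ge) auto
        \<comment> \<open>As \<open>n \<le> m\<close>, the exponent improves on one that is linear
          in \<open>m\<close> and does not involve \<open>n\<close>.\<close>
        also have "\<dots> \<le> 2 * exp (- (\<epsilon>\<^sup>2 / 2) * real m)"
        proof -
          have "0 < n" using False I by (simp add: n_def card_gt_0_iff)
          have "(\<epsilon>\<^sup>2 / 2) * real m * real n \<le> (\<epsilon>\<^sup>2 / 2) * real m * real m"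
            using I by (intro mult_left_mono) auto
          then have "(\<epsilon>\<^sup>2 / 2) * real m \<le> 2 * (\<epsilon> / 2 * real m)\<^sup>2 / real n"
            using \<open>0 < n\<close> by (simp add: field_simps power2_eq_square)
          then show ?thesis by simp
        qed
        finally show ?thesis .
      qed
    qed
  qed
  moreover have "(\<lambda>m. 2 * exp (- (\<epsilon>\<^sup>2 / 2) * real m)) \<longlonglongrightarrow> 0"
  proof -
    have "filterlim (\<lambda>m. (\<epsilon>\<^sup>2 / 2) * real m) at_top sequentially"
      using \<open>0 < \<epsilon>\<close> by (intro filterlim_tendsto_pos_mult_at_top[OF tendsto_const] filterlim_real_sequentially) auto
    then have "(\<lambda>m. exp (- ((\<epsilon>\<^sup>2 / 2) * real m))) \<longlonglongrightarrow> 0"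
      by (intro filterlim_compose[OF exp_at_bot] filterlim_compose[OF filterlim_uminus_at_bot_at_top])
    then show ?thesis using tendsto_mult_right_zero[of _ _ 2] by auto
  qed
  ultimately show ?thesis
    unfolding p_def[symmetric]
    by (rule real_tendsto_sandwich[OF always_eventually _ tendsto_const, rotated]) (rule allI measure_nonneg)+
qed

section \<open>One-factor scores\<close>

text \<open>Coordinate \<open>0\<close> of the noise is the common factor \<open>Z\<close>.\<close>

definition score :: "(nat \<Rightarrow> real) \<Rightarrow> (nat \<Rightarrow> real) \<Rightarrow> nat \<Rightarrow> (nat \<Rightarrow> real) \<Rightarrow> real" where
  "score \<nu> l i \<omega> = \<nu> i + l i * \<omega> 0 + sqrt (1 - (l i)\<^sup>2) * \<omega> i"

text \<open>A score equal to \<open>0\<close> gives the mirror candidate \<open>1/2\<close> but no knockoff candidate, so the two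
  rejection sets can differ there. Moving the null event where a score vanishes makes them agree
  at every sample point.\<close>

definition nonzero_score :: "(nat \<Rightarrow> real) \<Rightarrow> (nat \<Rightarrow> real) \<Rightarrow> nat \<Rightarrow> (nat \<Rightarrow> real) \<Rightarrow> real" where
  "nonzero_score \<nu> l i \<omega> = (if score \<nu> l i \<omega> = 0 then 1 else score \<nu> l i \<omega>)"

text \<open>The row of score \<open>i\<close> in the linear map from the noise coordinates
  \<open>0..m\<close> to the centred scores.\<close>

definition score_coeff :: "(nat \<Rightarrow> real) \<Rightarrow> nat \<Rightarrow> nat \<Rightarrow> real" where
  "score_coeff l i j = (if j = 0 then l i else if j = i then sqrt (1 - (l i)\<^sup>2) else 0)"

lemma borel_measurable_score [measurable]: "score \<nu> l i \<in> borel_measurable noise"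
  unfolding score_def by measurable

lemma borel_measurable_nonzero_score [measurable]: "nonzero_score \<nu> l i \<in> borel_measurable noise"
  unfolding nonzero_score_def by measurable

lemma sum_score_coeff:
  assumes "i \<in> {1..m}"
  shows "(\<Sum>j\<in>{0..m}. score_coeff l i j * x j) = l i * x 0 + sqrt (1 - (l i)\<^sup>2) * x i"
proof -
  have "(\<Sum>j\<in>{0..m}. score_coeff l i j * x j) = l i * x 0 + (\<Sum>j\<in>{1..m}. score_coeff l i j * x j)"
    by (simp add: sum.atLeast_Suc_atMost score_coeff_def)
  also have "(\<Sum>j\<in>{1..m}. score_coeff l i j * x j) = (\<Sum>j\<in>{1..m}. if j = i then sqrt (1 - (l i)\<^sup>2) * x i else 0)"
    by (intro sum.cong) (auto simp: score_coeff_def)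
  also have "\<dots> = sqrt (1 - (l i)\<^sup>2) * x i" using assms by simp
  finally show ?thesis .
qed

lemma score_eq_linear:
  "i \<in> {1..m} \<Longrightarrow> score \<nu> l i = (\<lambda>\<omega>. \<nu> i + (\<Sum>j\<in>{0..m}. score_coeff l i j * \<omega> j))"
  by (rule ext) (subst sum_score_coeff, auto simp: score_def)

text \<open>Distinct rows overlap only in coordinate 0, which leaves the product of the loadings;
  each row has unit length, whence variance 1 for every score.\<close>

lemma score_coeff_inner:
  assumes "i \<in> {1..m}" "k \<in> {1..m}" "\<And>i. \<bar>l i\<bar> < 1"
  shows "(\<Sum>j\<in>{0..m}. score_coeff l i j * score_coeff l k j)
    = l i * l k + (if i = k then 1 - (l i)\<^sup>2 else 0)"
proof -
  have "(l i)\<^sup>2 \<le> 1" using assms(3)[of i] by (simp add: abs_square_le_1)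
  then show ?thesis
    using assms(1,2) by (subst sum_score_coeff) (auto simp: score_coeff_def)
qed

lemma distributed_score:
  assumes "1 \<le> i" "\<And>i. \<bar>l i\<bar> < 1"
  shows "distributed noise lborel (score \<nu> l i) (\<lambda>x. ennreal (normal_density (\<nu> i) 1 x))"
proof -
  have 1: "(\<Sum>j\<in>{0..i}. (score_coeff l i j)\<^sup>2) = 1"
    using score_coeff_inner[of i i i l] assms by (simp add: power2_eq_square)
  then have "\<exists>j\<in>{0..i}. score_coeff l i j \<noteq> 0" by (rule contrapos_pp) simp
  from distributed_linear_noise[OF _ this, of "\<nu> i"] show ?thesis
    using assms(1) unfolding 1 by (subst score_eq_linear[of i i]) simp_all
qed

lemma AE_nonzero_score:
  assumes "1 \<le> i" "\<And>i. \<bar>l i\<bar> < 1"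
  shows "AE \<omega> in noise. nonzero_score \<nu> l i \<omega> = score \<nu> l i \<omega>"
proof -
  have "AE \<omega> in noise. score \<nu> l i \<omega> \<noteq> 0"
    by (subst noise.distributed_AE2[OF distributed_score[OF assms]])
       (use AE_lborel_singleton[of "0::real"] in \<open>auto elim: eventually_mono\<close>)
  then show ?thesis by eventually_elim (simp add: nonzero_score_def)
qed

lemma AE_nonzero_score_all:
  assumes "\<And>i. \<bar>l i\<bar> < 1"
  shows "AE \<omega> in noise. \<forall>i\<in>{1..m}. nonzero_score \<nu> l i \<omega> = score \<nu> l i \<omega>"
  using AE_nonzero_score[OF _ assms] by (intro AE_finite_allI) auto

lemma distributed_cong_AE:
  assumes "distributed M N X f" "AE x in M. Y x = X x" "Y \<in> measurable M N"
  shows "distributed M N Y f"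
proof -
  have "distr M N Y = distr M N X"
    using assms by (intro distr_cong_AE) (auto simp: distributed_def)
  then show ?thesis using assms by (simp add: distributed_def)
qed

lemma distributed_nonzero_score:
  assumes "1 \<le> i" "\<And>i. \<bar>l i\<bar> < 1"
  shows "distributed noise lborel (nonzero_score \<nu> l i) (\<lambda>x. ennreal (normal_density (\<nu> i) 1 x))"
  by (rule distributed_cong_AE[OF distributed_score[OF assms] AE_nonzero_score[OF assms]]) simp

lemma jointly_gaussian_nonzero_score:
  assumes "\<And>i. \<bar>l i\<bar> < 1"
  shows "jointly_gaussian noise {1..m} (nonzero_score \<nu> l)"
  unfolding jointly_gaussian_def
proof (intro conjI ballI allI)
  fix a :: "nat \<Rightarrow> real"
  define k where "k j = (\<Sum>i\<in>{1..m}. a i * score_coeff l i j)" for j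
  define c where "c = (\<Sum>i\<in>{1..m}. a i * \<nu> i)"
  let ?Y = "\<lambda>\<omega>. \<Sum>i\<in>{1..m}. a i * nonzero_score \<nu> l i \<omega>"
  \<comment> \<open>Exchanging the sums rewrites a combination of scores as a combination of
    independent noise coordinates.\<close>
  have "(\<Sum>i\<in>{1..m}. a i * score \<nu> l i \<omega>) = c + (\<Sum>j\<in>{0..m}. k j * \<omega> j)" for \<omega>
  proof -
    have "(\<Sum>i\<in>{1..m}. a i * score \<nu> l i \<omega>)
        = (\<Sum>i\<in>{1..m}. a i * \<nu> i + (\<Sum>j\<in>{0..m}. a i * score_coeff l i j * \<omega> j))"
      by (intro sum.cong refl, subst score_eq_linear) (auto simp: algebra_simps sum_distrib_left)
    also have "\<dots> = c + (\<Sum>j\<in>{0..m}. k j * \<omega> j)"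
      unfolding c_def k_def sum.distrib sum_distrib_right
      by (subst sum.swap) simp
    finally show ?thesis .
  qed
  then have AE: "AE \<omega> in noise. ?Y \<omega> = c + (\<Sum>j\<in>{0..m}. k j * \<omega> j)"
    using AE_nonzero_score_all[of l m \<nu>, OF assms] by (auto elim!: eventually_mono)
  have meas: "?Y \<in> borel_measurable noise" by measurable
  show "gaussian_var noise ?Y"
  proof (cases "\<exists>j\<in>{0..m}. k j \<noteq> 0")
    case True
    have "distributed noise lborel ?Y (\<lambda>x. ennreal (normal_density c (sqrt (\<Sum>j\<in>{0..m}. (k j)\<^sup>2)) x))"
      using meas by (intro distributed_cong_AE[OF distributed_linear_noise AE] True) auto
    moreover have "0 < (\<Sum>j\<in>{0..m}. (k j)\<^sup>2)"
      using True by (auto intro!: sum_pos2)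
    ultimately show ?thesis
      unfolding gaussian_var_def using meas by (blast intro: real_sqrt_gt_zero)
  next
    case False
    then have "AE \<omega> in noise. ?Y \<omega> = c" using AE by simp
    then show ?thesis unfolding gaussian_var_def using meas by blast
  qed
qed simp

lemma covariance_cong_AE:
  assumes "AE x in M. X x = X' x" "AE x in M. Y x = Y' x"
    and [measurable]: "X \<in> borel_measurable M" "X' \<in> borel_measurable M"
      "Y \<in> borel_measurable M" "Y' \<in> borel_measurable M"
  shows "covariance M X Y = covariance M X' Y'"
proof -
  have E: "integral\<^sup>L M X = integral\<^sup>L M X'" "integral\<^sup>L M Y = integral\<^sup>L M Y'"
    using assms by (auto intro!: integral_cong_AE)
  have "AE x in M. (X x - integral\<^sup>L M X') * (Y x - integral\<^sup>L M Y')
      = (X' x - integral\<^sup>L M X') * (Y' x - integral\<^sup>L M Y')"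
    using assms(1,2) by eventually_elim simp
  then show ?thesis unfolding covariance_def E by (intro integral_cong_AE) auto
qed

lemma covariance_nonzero_score:
  assumes "i \<in> {1..m}" "k \<in> {1..m}" "\<And>i. \<bar>l i\<bar> < 1"
  shows "covariance noise (nonzero_score \<nu> l i) (nonzero_score \<nu> l k)
    = l i * l k + (if i = k then 1 - (l i)\<^sup>2 else 0)"
proof -
  have "covariance noise (nonzero_score \<nu> l i) (nonzero_score \<nu> l k)
      = covariance noise (score \<nu> l i) (score \<nu> l k)"
    using assms by (intro covariance_cong_AE AE_nonzero_score) auto
  also have "\<dots> = (\<Sum>j\<in>{0..m}. score_coeff l i j * score_coeff l k j)"
    using assms(1,2) by (simp only: score_eq_linear covariance_linear_noise finite_atLeastAtMost)
  finally show ?thesis using score_coeff_inner[OF assms] by simp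
qed

text \<open>The quadratic form is the square contributed by the common factor plus the idiosyncratic
  variances \<open>1 - (l i)\<^sup>2\<close> weighted by \<open>(a i)\<^sup>2\<close>; the latter
  are positive because all loadings are below 1 in absolute value.\<close>

lemma pos_def_nonzero_score:
  assumes "\<And>i. \<bar>l i\<bar> < 1"
  shows "pos_def_on {1..m} (\<lambda>i j. covariance noise (nonzero_score \<nu> l i) (nonzero_score \<nu> l j))"
  unfolding pos_def_on_def
proof (intro conjI ballI allI impI)
  fix a :: "nat \<Rightarrow> real" assume "\<exists>i\<in>{1..m}. a i \<noteq> 0"
  then obtain i0 where i0: "i0 \<in> {1..m}" "a i0 \<noteq> 0" by blast
  have l: "(l i)\<^sup>2 < 1" for i using assms[of i] by (simp add: abs_square_less_1)
  have "(\<Sum>i\<in>{1..m}. \<Sum>j\<in>{1..m}. a i * covariance noise (nonzero_score \<nu> l i) (nonzero_score \<nu> l j) * a j)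
      = (\<Sum>i\<in>{1..m}. \<Sum>j\<in>{1..m}. (a i * l i) * (a j * l j) + (if j = i then (a i)\<^sup>2 * (1 - (l i)\<^sup>2) else 0))"
    using assms by (intro sum.cong refl)
      (auto simp: covariance_nonzero_score algebra_simps power2_eq_square)
  also have "\<dots> = (\<Sum>i\<in>{1..m}. a i * l i)\<^sup>2 + (\<Sum>i\<in>{1..m}. (a i)\<^sup>2 * (1 - (l i)\<^sup>2))"
    by (simp add: sum.distrib sum_product power2_eq_square)
  also have "\<dots> > 0"
    using l i0 by (intro add_nonneg_pos sum_pos2[of _ i0]) (auto simp: less_imp_le)
  finally show "0 < (\<Sum>i\<in>{1..m}. \<Sum>j\<in>{1..m}. a i * covariance noise (nonzero_score \<nu> l i) (nonzero_score \<nu> l j) * a j)" .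
qed (use assms in \<open>auto simp: covariance_nonzero_score\<close>)

lemma correlation_nonzero_score:
  assumes "i \<in> {1..m}" "k \<in> {1..m}" "i \<noteq> k" "\<And>i. \<bar>l i\<bar> < 1"
  shows "correlation noise (nonzero_score \<nu> l i) (nonzero_score \<nu> l k) = l i * l k"
  using assms unfolding correlation_def
  by (simp add: covariance_nonzero_score[of _ m] power2_eq_square)

section \<open>Laws of the p-values\<close>

lemma distr_one_minus_cdf_null:
  assumes "distributed M lborel X (\<lambda>x. ennreal (std_normal_density x))"
  shows "distr M borel (\<lambda>\<omega>. 1 - \<Phi> (X \<omega>)) = uniform_measure lborel {0<..<1}"
proof -
  have [measurable]: "X \<in> borel_measurable M" using assms by (simp add: distributed_def)
  have "distr M borel X = distr M lborel X" by (rule distr_cong) auto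
  also have "\<dots> = gauss" using assms by (simp add: distributed_def)
  finally have "distr (distr M borel X) borel (\<lambda>x. 1 - \<Phi> x) = uniform_measure lborel {0<..<1}"
    by (simp add: distr_one_minus_cdf_gauss)
  then show ?thesis by (subst (asm) distr_distr) (auto simp: comp_def)
qed

text \<open>A coupling: subtracting \<mu> from the score gives an exactly uniform p-value on the
  same space that is pointwise at least as large.\<close>

lemma stoch_smaller_one_minus_cdf:
  assumes "prob_space M" "distributed M lborel X (\<lambda>x. ennreal (normal_density \<mu> 1 x))" "0 \<le> \<mu>"
  shows "stoch_smaller (distr M borel (\<lambda>\<omega>. 1 - \<Phi> (X \<omega>))) (uniform_measure lborel {0<..<1})"
  unfolding stoch_smaller_def
proof
  fix x :: real
  interpret prob_space M by fact
  have [measurable]: "X \<in> borel_measurable M" using assms by (simp add: distributed_def)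
  have "distributed M lborel (\<lambda>\<omega>. - \<mu> + 1 * X \<omega>) (normal_density (- \<mu> + 1 * \<mu>) (\<bar>1\<bar> * 1))"
    using assms(2) by (intro normal_density_affine) auto
  then have U: "distr M borel (\<lambda>\<omega>. 1 - \<Phi> (- \<mu> + X \<omega>)) = uniform_measure lborel {0<..<1}"
    by (intro distr_one_minus_cdf_null) simp
  have C: "cdf (distr M borel (\<lambda>\<omega>. 1 - \<Phi> (Y \<omega>))) x = prob {\<omega>\<in>space M. 1 - \<Phi> (Y \<omega>) \<le> x}"
    if [measurable]: "Y \<in> borel_measurable M" for Y
    unfolding cdf_def[of "distr _ _ _"]
    by (subst measure_distr) (auto intro!: arg_cong[where f=prob])
  have "prob {\<omega>\<in>space M. 1 - \<Phi> (- \<mu> + X \<omega>) \<le> x} \<le> prob {\<omega>\<in>space M. 1 - \<Phi> (X \<omega>) \<le> x}"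
  proof (rule finite_measure_mono)
    have "1 - \<Phi> (X \<omega>) \<le> 1 - \<Phi> (- \<mu> + X \<omega>)" for \<omega> using assms(3) by simp
    then show "{\<omega>\<in>space M. 1 - \<Phi> (- \<mu> + X \<omega>) \<le> x} \<subseteq> {\<omega>\<in>space M. 1 - \<Phi> (X \<omega>) \<le> x}"
      by (blast intro: order_trans)
  qed measurable
  then show "cdf (uniform_measure lborel {0<..<1}) x \<le> cdf (distr M borel (\<lambda>\<omega>. 1 - \<Phi> (X \<omega>))) x"
    unfolding U[symmetric] by (simp add: C)
qed

section \<open>Measurability and general bounds for FDR and power\<close>

lemma measurable_card_knockoff_rejections:
  assumes [measurable]: "\<And>i. X i \<in> borel_measurable M"
  shows "(\<lambda>\<omega>. card (knockoff_rejections q m (\<lambda>i. X i \<omega>) \<inter> H)) \<in> measurable M (count_space UNIV)"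
proof (rule measurable_card)
  fix i
  have "(\<lambda>\<omega>. real (N_plus m (\<lambda>i. X i \<omega>) \<bar>X j \<omega>\<bar>)) \<in> borel_measurable M" 
    and "(\<lambda>\<omega>. real (N_minus m (\<lambda>i. X i \<omega>) \<bar>X j \<omega>\<bar>)) \<in> borel_measurable M" for j
    unfolding N_plus_def N_minus_def
    by (auto intro!: measurable_compose[OF measurable_card])
  note [measurable] = this
  \<comment> \<open>The existential description of a rejection turns the event into a finite union
    over the candidate index \<open>j\<close>.\<close>
  have eq: "{\<omega> \<in> space M. i \<in> knockoff_rejections q m (\<lambda>i. X i \<omega>) \<inter> H} =
    (if i \<in> {1..m} \<inter> H then (\<Union>j\<in>{1..m}. {\<omega>\<in>space M. X j \<omega> \<noteq> 0 \<and> (1 + real (N_minus m (\<lambda>i. X i \<omega>) \<bar>X j \<omega>\<bar>))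
       / max (real (N_plus m (\<lambda>i. X i \<omega>) \<bar>X j \<omega>\<bar>)) 1 \<le> q \<and> \<bar>X j \<omega>\<bar> \<le> X i \<omega>}) else {})"
    by (auto simp: knockoff_rejections_iff of_nat_max)
  show "{\<omega> \<in> space M. i \<in> knockoff_rejections q m (\<lambda>i. X i \<omega>) \<inter> H} \<in> sets M"
    unfolding eq by (auto intro!: sets.finite_UN)
qed

text \<open>With \<open>v\<close> rejected nulls there are at most \<open>v + card H1\<close>, hence
  at most \<open>(1 + \<eta>) * v\<close>, rejections, and the product of \<open>1 - \<eta>\<close>
  and \<open>1 + \<eta>\<close> is at most 1.\<close>

lemma fdp_ge:
  fixes m :: nat and w :: "nat \<Rightarrow> real"
  assumes H: "H0 \<subseteq> {1..m}" "H1 = {1..m} - H0"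
    and R: "R \<subseteq> {1..m}" "{i\<in>{1..m}. t \<le> w i} \<subseteq> R"
    and V: "0 < card {i\<in>H0. t \<le> w i}" "real (card H1) \<le> \<eta> * real (card {i\<in>H0. t \<le> w i})"
  shows "1 - \<eta> \<le> real (card (R \<inter> H0)) / real (max (card R) 1)"
proof -
  define v where "v = card (R \<inter> H0)"
  have fin: "finite R" "finite H1" using finite_subset[OF R(1) finite_atLeastAtMost] by (simp_all add: H(2))
  have "{i\<in>H0. t \<le> w i} \<subseteq> R \<inter> H0" using R(2) H(1) by blast
  then have Vv: "card {i\<in>H0. t \<le> w i} \<le> v"
    unfolding v_def using fin by (intro card_mono) auto
  then have v: "0 < v" using V(1) by linarith
  have "0 \<le> \<eta> * real (card {i\<in>H0. t \<le> w i})"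
    using V(2) of_nat_0_le_iff by (rule order_trans[rotated])
  then have "0 \<le> \<eta>" using V(1) by (simp add: zero_le_mult_iff)
  have "R = (R \<inter> H0) \<union> (R \<inter> H1)" using R(1) H by blast
  moreover have "card ((R \<inter> H0) \<union> (R \<inter> H1)) = v + card (R \<inter> H1)"
    unfolding v_def using fin H(2) by (intro card_Un_disjoint) auto
  ultimately have cR: "card R = v + card (R \<inter> H1)" by simp
  have "real (card (R \<inter> H1)) \<le> real (card H1)"
    using fin by (intro of_nat_mono card_mono) auto
  also have "\<dots> \<le> \<eta> * real v"
    using V(2) mult_left_mono[OF of_nat_mono[OF Vv] \<open>0 \<le> \<eta>\<close>] by (rule order_trans)
  finally have "real (card R) \<le> real v + \<eta> * real v" and pos: "v \<le> card R"
    unfolding cR by simp_all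
  then have le: "real (card R) \<le> (1 + \<eta>) * real v" by (simp add: algebra_simps)
  have "(1 - \<eta>) * real (card R) \<le> real v"
  proof (cases "\<eta> \<le> 1")
    case True
    then have "(1 - \<eta>) * real (card R) \<le> (1 - \<eta>) * ((1 + \<eta>) * real v)"
      using le by (intro mult_left_mono) auto
    also have "\<dots> = real v - \<eta>\<^sup>2 * real v" by (simp add: algebra_simps power2_eq_square)
    also have "\<dots> \<le> real v" by simp
    finally show ?thesis .
  next
    case False
    then have "(1 - \<eta>) * real (card R) \<le> 0" by (intro mult_nonpos_nonneg) auto
    then show ?thesis by (rule order_trans) simp
  qed
  moreover have "max (card R) 1 = card R" "0 < card R" using v pos by auto
  ultimately show ?thesis by (simp add: v_def le_divide_eq)
qed

text \<open>The bound on the event is only asked almost everywhere, because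
  \<open>nonzero_score\<close> agrees with \<open>score\<close> only up to a null set.\<close>

lemma expectation_ge_on_event:
  fixes f :: "'a \<Rightarrow> real"
  assumes "prob_space M" "f \<in> borel_measurable M" "G \<in> sets M"
    and "\<And>x. 0 \<le> f x" "\<And>x. f x \<le> 1" and "AE x in M. x \<in> G \<longrightarrow> C \<le> f x"
  shows "C * measure M G \<le> integral\<^sup>L M f"
proof -
  interpret prob_space M by fact
  have "C * measure M G = (\<integral>x. C * indicator G x \<partial>M)" using assms(3) by simp
  also have "\<dots> \<le> integral\<^sup>L M f"
  proof (rule integral_mono_AE)
    show "integrable M f"
      using assms(2,4,5) by (intro integrable_const_bound[where B=1]) auto
    show "AE x in M. C * indicator G x \<le> f x"
      using assms(6) by eventually_elim (use assms(4) in \<open>auto simp: indicator_def\<close>)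
  qed (use assms(3) in \<open>auto simp: emeasure_eq_measure\<close>)
  finally show ?thesis .
qed

section \<open>Ratios of Gaussian tails and the typical range of the factor\<close>

lemma eventually_upper_tail_shift:
  assumes y: "filterlim y at_top F" and d: "\<forall>\<^sub>F t in F. e \<le> d t" and "0 < e" "0 < \<kappa>"
  shows "\<forall>\<^sub>F t in F. upper_tail (y t + d t) \<le> \<kappa> * upper_tail (y t)"
proof -
  \<comment> \<open>The second bound makes \<open>exp (- (e * y t))\<close> at most \<kappa>;
    nonnegativity of \<open>y t\<close> lets the gap \<open>d t\<close> be replaced by its lower
    bound \<open>e\<close>.\<close>
  have "\<forall>\<^sub>F t in F. max 0 (- ln \<kappa> / e) \<le> y t"
    using y unfolding filterlim_at_top by blast
  with d show ?thesis
  proof eventually_elim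
    case (elim t)
    have "- ln \<kappa> \<le> e * y t" using elim \<open>0 < e\<close> by (simp add: field_simps)
    also have "\<dots> \<le> d t * y t" using elim by (intro mult_right_mono) auto
    finally have "exp (- (d t * y t)) \<le> exp (ln \<kappa>)" by simp
    then have "exp (- (d t * y t)) * upper_tail (y t) \<le> \<kappa> * upper_tail (y t)"
      using \<open>0 < \<kappa>\<close> upper_tail_pos[of "y t"] by (intro mult_right_mono) auto
    with upper_tail_shift[of "d t" "y t"] show ?case using elim \<open>0 < e\<close> by linarith
  qed
qed

text \<open>Each of four regions, the two beyond \<open>B\<close> and the two between 0 and \<delta>
  on either side, costs at most \<open>\<eta> / 4\<close>.\<close>

lemma gauss_annulus:
  assumes "0 < \<eta>"
  shows "\<exists>\<delta> B. 0 < \<delta> \<and> \<delta> \<le> B \<and> 1 - \<eta> < measure gauss {x. \<delta> \<le> \<bar>x\<bar> \<and> \<bar>x\<bar> \<le> B}"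
proof -
  have "(\<Phi> \<longlongrightarrow> 1 / 2) (at_right 0)"
    using isCont_cdf_gauss[of 0] unfolding isCont_def cdf_gauss_0
    by (rule tendsto_within_subset) simp
  from order_tendstoD(2)[OF this, of "1/2 + \<eta>/4"] assms
  have "\<forall>\<^sub>F x in at_right 0. \<Phi> x < 1/2 + \<eta>/4" by simp
  from eventually_happens[OF eventually_conj[OF this eventually_at_right_less[of 0]]]
  obtain \<delta> where \<delta>: "0 < \<delta>" "\<Phi> \<delta> < 1/2 + \<eta>/4" by auto
  have "\<forall>\<^sub>F x in at_top. 1 - \<eta>/4 < \<Phi> x"
    using order_tendstoD(1)[OF gauss.cdf_lim_at_top_prob, of "1 - \<eta>/4"] assms by simp
  from eventually_happens[OF eventually_conj[OF this eventually_gt_at_top[of \<delta>]]]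
  obtain B where B: "\<delta> < B" "1 - \<eta>/4 < \<Phi> B" by auto
  have "measure gauss {\<delta><..B} + measure gauss {-B<..-\<delta>} = measure gauss ({\<delta><..B} \<union> {-B<..-\<delta>})"
    using \<delta> by (intro gauss.finite_measure_Union[symmetric]) auto
  also have "\<dots> \<le> measure gauss {x. \<delta> \<le> \<bar>x\<bar> \<and> \<bar>x\<bar> \<le> B}"
    using \<delta> by (intro gauss.finite_measure_mono) auto
  finally have "2 * (\<Phi> B - \<Phi> \<delta>) \<le> measure gauss {x. \<delta> \<le> \<bar>x\<bar> \<and> \<bar>x\<bar> \<le> B}"
    using gauss.cdf_diff_eq[of \<delta> B] gauss.cdf_diff_eq[of "-B" "-\<delta>"] B by (simp add: cdf_gauss_uminus)
  with \<delta> B show ?thesis by (intro exI[of _ \<delta>] exI[of _ B]) auto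
qed

section \<open>The two null blocks\<close>

text \<open>\<open>t\<^sub>1\<close> serves the event \<open>\<delta> \<le> Z\<close> and \<open>t\<^sub>2\<close> the event \<open>- B \<le> Z \<le> - \<delta>\<close>. The
  left-hand sides of the two block inequalities bound the limiting fractions of scores below \<open>- t\<^sub>1\<close> and
  \<open>- t\<^sub>2\<close> on these events, the right-hand sides are \<open>q\<close> times a lower bound for those above \<open>t\<^sub>1\<close> and \<open>t\<^sub>2\<close>.\<close>

locale block_scores =
  fixes q \<eta> c b \<delta> B \<beta> \<gamma> t\<^sub>1 t\<^sub>2 \<mu> :: real
  assumes q: "0 < q" "q < 1" and \<eta>: "0 < \<eta>" "\<eta> < 1"
    and loadings: "0 < b" "b < c" "c < 1"
    and range: "0 < \<delta>" "1 - \<eta> < measure gauss {x. \<delta> \<le> \<bar>x\<bar> \<and> \<bar>x\<bar> \<le> B}"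
    and fractions: "0 < \<beta>" "0 < \<gamma>" "\<gamma> + \<beta> < 1"
    and thresholds: "0 < t\<^sub>1" "0 < t\<^sub>2" and \<mu>: "0 < \<mu>"
    and large_block:
      "\<gamma> + \<beta> + (1 - \<gamma> - \<beta>) * upper_tail ((t\<^sub>1 + c * \<delta>) / sqrt (1 - c\<^sup>2))
         < q * ((1 - \<gamma> - \<beta>) * upper_tail ((t\<^sub>1 - c * \<delta>) / sqrt (1 - c\<^sup>2)))"
    and small_block:
      "\<gamma> + \<beta> * upper_tail ((t\<^sub>2 + b * \<delta>) / sqrt (1 - b\<^sup>2))
         + (1 - \<gamma> - \<beta>) * upper_tail ((t\<^sub>2 - c * B) / sqrt (1 - c\<^sup>2))
         < q * (\<beta> * upper_tail ((t\<^sub>2 - b * \<delta>) / sqrt (1 - b\<^sup>2)))"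
    and few_nonnulls:
      "\<gamma> < \<eta> * ((1 - \<gamma> - \<beta>) * upper_tail ((t\<^sub>1 - c * \<delta>) / sqrt (1 - c\<^sup>2)))"
      "\<gamma> < \<eta> * (\<beta> * upper_tail ((t\<^sub>2 - b * \<delta>) / sqrt (1 - b\<^sup>2)))"
    and strong_signal: "1 - \<eta> < upper_tail (max t\<^sub>1 t\<^sub>2 - \<mu>)"

text \<open>The order of the choices matters, each depending only on earlier ones: \<delta> and
  \<open>B\<close>, then \<open>t\<^sub>1\<close>, then \<beta> small against the large block's tail
  at \<open>t\<^sub>1\<close>, then \<open>t\<^sub>2\<close> (which depends on \<beta>), then
  \<gamma> small against the small block's tail at \<open>t\<^sub>2\<close>, and finally
  \<mu>.\<close>

lemma block_scores_exist:
  assumes q: "0 < q" "q < 1" and \<eta>: "0 < \<eta>" "\<eta> < 1" and cb: "0 < b" "b < c" "c < 1"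
  shows "\<exists>\<delta> B \<beta> \<gamma> t\<^sub>1 t\<^sub>2 \<mu>. block_scores q \<eta> c b \<delta> B \<beta> \<gamma> t\<^sub>1 t\<^sub>2 \<mu>"
proof -
  define s where "s = sqrt (1 - c\<^sup>2)"
  define r where "r = sqrt (1 - b\<^sup>2)"
  have sr: "0 < s" "s < r"
    using cb by (auto simp: s_def r_def power_strict_mono abs_square_less_1)
  obtain \<delta> B where \<delta>: "0 < \<delta>" "\<delta> \<le> B" and range: "1 - \<eta> < measure gauss {x. \<delta> \<le> \<bar>x\<bar> \<and> \<bar>x\<bar> \<le> B}"
    using gauss_annulus[OF \<eta>(1)] by blast
  have lin: "filterlim (\<lambda>t. (t - x) / v) at_top at_top" if "0 < v" for x v :: real
    using that by real_asymp
  \<comment> \<open>The two standardised levels differ by the fixed amount \<open>2 * x / v\<close>,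
    so the tail on the wrong side becomes negligible as \<open>t\<close> grows.\<close>
  have two_sided: "\<forall>\<^sub>F t in at_top. upper_tail ((t + x) / v) \<le> \<kappa> * upper_tail ((t - x) / v)"
    if "0 < x" "0 < v" "0 < \<kappa>" for x v \<kappa> :: real
  proof -
    have "\<forall>\<^sub>F t in at_top. upper_tail ((t - x) / v + 2 * x / v) \<le> \<kappa> * upper_tail ((t - x) / v)"
      using that by (intro eventually_upper_tail_shift[where e="2 * x / v"] lin) auto
    moreover have "(t - x) / v + 2 * x / v = (t + x) / v" for t
      by (simp add: add_divide_distrib diff_divide_distrib)
    ultimately show ?thesis by simp
  qed
  have "\<forall>\<^sub>F t in at_top. upper_tail ((t + c * \<delta>) / s) \<le> q / 2 * upper_tail ((t - c * \<delta>) / s)"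
    using two_sided[of "c * \<delta>" s "q / 2"] cb \<delta> sr q by simp
  from eventually_happens[OF eventually_conj[OF this eventually_gt_at_top[of 0]]]
  obtain t\<^sub>1 where t1: "0 < t\<^sub>1" "upper_tail ((t\<^sub>1 + c * \<delta>) / s) \<le> q / 2 * upper_tail ((t\<^sub>1 - c * \<delta>) / s)"
    by auto
  define T1 where "T1 = upper_tail ((t\<^sub>1 - c * \<delta>) / s)"
  \<comment> \<open>At \<open>t\<^sub>1\<close> the whole small block is conceded to the lower tail,
    so \<beta> must be a small multiple of \<open>q * T1\<close>.\<close>
  define \<beta> where "\<beta> = q * T1 / 16"
  have T1: "0 < T1" "T1 < 1" by (auto simp: T1_def upper_tail_pos upper_tail_less_1)
  then have "q * T1 \<le> 1 * 1" using q by (intro mult_mono) auto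
  with T1 q have \<beta>: "0 < \<beta>" "\<beta> \<le> 1 / 16" by (auto simp: \<beta>_def)
  have "\<forall>\<^sub>F t in at_top. upper_tail ((t + b * \<delta>) / r) \<le> q / 4 * upper_tail ((t - b * \<delta>) / r)"
    using two_sided[of "b * \<delta>" r "q / 4"] cb \<delta> sr q by simp
  \<comment> \<open>Since \<open>s < r\<close>, the level standardised by \<open>s\<close>
    eventually exceeds the one standardised by \<open>r\<close> by at least 1 for every larger
    \<open>t\<close>, whatever \<open>B\<close> is. The factor \<beta> compensates for the size of
    the large block.\<close>
  moreover have "\<forall>\<^sub>F t in at_top. upper_tail ((t - c * B) / s) \<le> q / 4 * \<beta> * upper_tail ((t - b * \<delta>) / r)"
  proof -
    have "filterlim (\<lambda>t. t * (1 / s - 1 / r) + (b * \<delta> / r - c * B / s)) at_top at_top"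
    proof -
      have "0 < 1 / s - 1 / r" using sr by (simp add: frac_less2)
      then show ?thesis by real_asymp
    qed
    then have "\<forall>\<^sub>F t in at_top. 1 \<le> t * (1 / s - 1 / r) + (b * \<delta> / r - c * B / s)"
      unfolding filterlim_at_top by blast
    then have "\<forall>\<^sub>F t in at_top. 1 \<le> (t - c * B) / s - (t - b * \<delta>) / r"
      by eventually_elim (simp add: diff_divide_distrib algebra_simps)
    then have "\<forall>\<^sub>F t in at_top. upper_tail ((t - b * \<delta>) / r + ((t - c * B) / s - (t - b * \<delta>) / r))
        \<le> q / 4 * \<beta> * upper_tail ((t - b * \<delta>) / r)"
      using sr q \<beta> by (intro eventually_upper_tail_shift[where e=1] lin) auto
    then show ?thesis by simp
  qed
  ultimately have "\<forall>\<^sub>F t in at_top. 0 < t \<and> upper_tail ((t + b * \<delta>) / r) \<le> q / 4 * upper_tail ((t - b * \<delta>) / r)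
      \<and> upper_tail ((t - c * B) / s) \<le> q / 4 * \<beta> * upper_tail ((t - b * \<delta>) / r)"
    using eventually_gt_at_top[of 0] by eventually_elim simp
  then obtain t\<^sub>2 where t2: "0 < t\<^sub>2" "upper_tail ((t\<^sub>2 + b * \<delta>) / r) \<le> q / 4 * upper_tail ((t\<^sub>2 - b * \<delta>) / r)"
      "upper_tail ((t\<^sub>2 - c * B) / s) \<le> q / 4 * \<beta> * upper_tail ((t\<^sub>2 - b * \<delta>) / r)"
    by (auto dest!: eventually_happens)
  define T2 where "T2 = upper_tail ((t\<^sub>2 - b * \<delta>) / r)"
  \<comment> \<open>One choice meets four requirements: discarding suitable factors below 1 gives
    the bounds \<gamma>1 to \<gamma>4.\<close>
  define \<gamma> where "\<gamma> = q * \<eta> * \<beta> * T2 / 8"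
  have T2: "0 < T2" "T2 < 1" by (auto simp: T2_def upper_tail_pos upper_tail_less_1)
  have \<gamma>: "0 < \<gamma>" using q \<eta> \<beta> T2 by (simp add: \<gamma>_def)
  have "q * \<eta> * \<beta> * T2 \<le> 1 * \<eta> * \<beta> * 1" using q \<eta> \<beta> T2 by (intro mult_mono) auto
  then have \<gamma>1: "\<gamma> \<le> \<eta> * \<beta> / 8" by (simp add: \<gamma>_def)
  have "\<eta> * \<beta> \<le> 1 * \<beta>" using \<eta> \<beta> by (intro mult_right_mono) auto
  with \<gamma>1 have \<gamma>2: "\<gamma> \<le> \<beta> / 8" by simp
  have "q * \<beta> * T2 * \<eta> \<le> q * \<beta> * T2 * 1" using q \<eta> \<beta> T2 by (intro mult_left_mono) auto
  then have \<gamma>3: "\<gamma> \<le> q * \<beta> * T2 / 8" by (simp add: \<gamma>_def mult_ac)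
  have "\<eta> * \<beta> * T2 * q \<le> \<eta> * \<beta> * T2 * 1" using q \<eta> \<beta> T2 by (intro mult_left_mono) auto
  then have \<gamma>4: "\<gamma> \<le> \<eta> * \<beta> * T2 / 8" by (simp add: \<gamma>_def mult_ac)
  define \<alpha> where "\<alpha> = 1 - \<gamma> - \<beta>"
  have \<alpha>: "7 / 8 \<le> \<alpha>" "\<alpha> \<le> 1" using \<beta> \<gamma> \<gamma>2 by (auto simp: \<alpha>_def)
  \<comment> \<open>A large signal pushes almost all nonnulls above both levels.\<close>
  have "\<forall>\<^sub>F x in at_top. 1 - \<eta> < \<Phi> (- (max t\<^sub>1 t\<^sub>2 - x))"
  proof -
    have "filterlim (\<lambda>x. - (max t\<^sub>1 t\<^sub>2 - x)) at_top at_top" by real_asymp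
    from filterlim_compose[OF gauss.cdf_lim_at_top_prob this]
    show ?thesis by (rule order_tendstoD(1)) (use \<eta> in simp)
  qed
  from eventually_happens[OF eventually_conj[OF this eventually_gt_at_top[of 0]]]
  obtain \<mu> where \<mu>: "0 < \<mu>" "1 - \<eta> < \<Phi> (- (max t\<^sub>1 t\<^sub>2 - \<mu>))" by auto
  have "block_scores q \<eta> c b \<delta> B \<beta> \<gamma> t\<^sub>1 t\<^sub>2 \<mu>"
  proof (unfold_locales, goal_cases)
    \<comment> \<open>Goals 16 to 20 are \<open>large_block\<close>, \<open>small_block\<close>, the
      two parts of \<open>few_nonnulls\<close>, and \<open>strong_signal\<close>. Here
      \<open>\<gamma> + \<beta>\<close> is at most \<open>9 / 128 * q * T1\<close>, well below the
      remaining \<open>q * \<alpha> * T1 / 2\<close>, which is at least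
      \<open>7 / 16 * q * T1\<close>.\<close>
    case 16
    have "\<alpha> * upper_tail ((t\<^sub>1 + c * \<delta>) / s) \<le> \<alpha> * (q / 2 * T1)"
      using t1 \<alpha> unfolding T1_def by (intro mult_left_mono) auto
    moreover have "(7 / 8) * (q * T1) \<le> \<alpha> * (q * T1)" using \<alpha> q T1 by (intro mult_right_mono) auto
    moreover have "0 < q * T1" using q T1 by simp
    ultimately show ?case
      using \<gamma>2 \<beta> unfolding T1_def[symmetric] s_def[symmetric] \<alpha>_def[symmetric]
      by (simp add: \<beta>_def algebra_simps)
  next
    \<comment> \<open>The three contributions are at most 1/8, 1/4 and 1/4 of
      \<open>q * \<beta> * T2\<close>.\<close>
    case 17
    have "\<alpha> * upper_tail ((t\<^sub>2 - c * B) / s) \<le> 1 * (q / 4 * \<beta> * T2)"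
      using t2 \<alpha> upper_tail_pos unfolding T2_def by (intro mult_mono) (auto intro: less_imp_le)
    moreover have "\<beta> * upper_tail ((t\<^sub>2 + b * \<delta>) / r) \<le> \<beta> * (q / 4 * T2)"
      using t2 \<beta> unfolding T2_def by (intro mult_left_mono) auto
    moreover have "0 < q * \<beta> * T2" using q \<beta> T2 by simp
    ultimately show ?case
      using \<gamma>3 unfolding T2_def[symmetric] s_def[symmetric] r_def[symmetric] \<alpha>_def[symmetric]
      by (simp add: algebra_simps)
  next
    case 18
    have "\<eta> * (q * T1) \<le> \<eta> * (1 * T1)" using q \<eta> T1 by (intro mult_left_mono mult_right_mono) auto
    moreover have "\<eta> * ((7 / 8) * T1) \<le> \<eta> * (\<alpha> * T1)" using \<alpha> \<eta> T1 by (intro mult_left_mono mult_right_mono) auto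
    moreover have "0 < \<eta> * T1" using \<eta> T1 by simp
    moreover have "\<gamma> \<le> \<eta> * (q * T1) / 128" using \<gamma>1 by (simp add: \<beta>_def)
    ultimately show ?case
      unfolding T1_def[symmetric] s_def[symmetric] \<alpha>_def[symmetric] by linarith
  next
    case 19
    have "0 < \<eta> * \<beta> * T2" using \<eta> \<beta> T2 by simp
    then show ?case using \<gamma>4
      unfolding T2_def[symmetric] r_def[symmetric] by (simp add: mult_ac)
  next
    case 20
    show ?case using \<mu>(2) by (simp only: cdf_gauss_uminus upper_tail_eq)
  qed (use q \<eta> cb \<delta> range \<beta> \<gamma> \<gamma>2 t1 t2 \<mu> in auto)
  then show ?thesis by blast
qed

section \<open>Blocks, loadings and signals in dimension \<open>m\<close>\<close>

lemma nat_floor_fraction_tendsto: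
  fixes x :: real
  assumes "0 \<le> x"
  shows "(\<lambda>m. real (nat \<lfloor>x * real m\<rfloor>) / real m) \<longlonglongrightarrow> x"
proof (rule real_tendsto_sandwich)
  show "\<forall>\<^sub>F m in sequentially. x - 1 / real m \<le> real (nat \<lfloor>x * real m\<rfloor>) / real m"
    using eventually_gt_at_top[of 0]
  proof eventually_elim
    case (elim m)
    have "x * real m - 1 \<le> real (nat \<lfloor>x * real m\<rfloor>)" by linarith
    from divide_right_mono[OF this, of "real m"] elim show ?case by (simp add: diff_divide_distrib)
  qed
  show "\<forall>\<^sub>F m in sequentially. real (nat \<lfloor>x * real m\<rfloor>) / real m \<le> x"
    using eventually_gt_at_top[of 0]
  proof eventually_elim
    case (elim m)
    have "real (nat \<lfloor>x * real m\<rfloor>) \<le> x * real m" using assms by simp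
    with elim show ?case by (simp add: field_simps)
  qed
  show "(\<lambda>m. x - 1 / real m) \<longlonglongrightarrow> x" by real_asymp
qed simp

context block_scores
begin

definition "count_nonnull m = nat \<lfloor>\<gamma> * real m\<rfloor>"
text \<open>The coordinates are ordered as nonnulls, small block, large block. Rounding the
  cumulative fraction gives the last index of the small block, so the three blocks partition
  \<open>{1..m}\<close>.\<close>

definition "count_outer m = nat \<lfloor>(\<gamma> + \<beta>) * real m\<rfloor>"

definition "nonnulls m = {1..count_nonnull m}"
definition "nulls m = {count_nonnull m<..m}"
definition "small m = {count_nonnull m<..count_outer m}"
definition "large m = {count_outer m<..m}"

definition "loading m i = (if i \<le> count_nonnull m then 0 else if i \<le> count_outer m then - b else c)"
definition "signal m i = (if i \<le> count_nonnull m then \<mu> else 0)"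

abbreviation "\<alpha> \<equiv> 1 - \<gamma> - \<beta>"
abbreviation "s \<equiv> sqrt (1 - c\<^sup>2)"
abbreviation "r \<equiv> sqrt (1 - b\<^sup>2)"
abbreviation "t\<^sub>0 \<equiv> max t\<^sub>1 t\<^sub>2"

lemma noise_levels_pos: "0 < s" "0 < r"
  using loadings by (auto simp: abs_square_less_1)

lemma count_bounds:
  "count_nonnull m \<le> count_outer m" "count_outer m \<le> m"
  "real (count_nonnull m) \<le> \<gamma> * real m" "real (count_outer m) \<le> (\<gamma> + \<beta>) * real m"
proof -
  show le: "real (count_nonnull m) \<le> \<gamma> * real m" "real (count_outer m) \<le> (\<gamma> + \<beta>) * real m"
    using fractions by (simp_all add: count_nonnull_def count_outer_def)
  have "\<gamma> * real m \<le> (\<gamma> + \<beta>) * real m" using fractions by (intro mult_right_mono) auto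
  then show "count_nonnull m \<le> count_outer m"
    unfolding count_nonnull_def count_outer_def by (intro nat_mono floor_mono)
  have "(\<gamma> + \<beta>) * real m \<le> 1 * real m" using fractions by (intro mult_right_mono) auto
  with le(2) show "count_outer m \<le> m" by linarith
qed

lemma blocks_subset: "nonnulls m \<subseteq> {1..m}" "nulls m \<subseteq> {1..m}" "small m \<subseteq> nulls m" "large m \<subseteq> nulls m"
  using count_bounds(1,2)[of m] by (auto simp: nonnulls_def nulls_def small_def large_def)

lemma nonnulls_eq: "nonnulls m = {1..m} - nulls m"
  using count_bounds(1,2)[of m] by (auto simp: nonnulls_def nulls_def)

lemma block_densities:
  "(\<lambda>m. real (card (nonnulls m)) / real m) \<longlonglongrightarrow> \<gamma>"
  "(\<lambda>m. real (card (small m)) / real m) \<longlonglongrightarrow> \<beta>"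
  "(\<lambda>m. real (card (large m)) / real m) \<longlonglongrightarrow> \<alpha>"
proof -
  have H: "(\<lambda>m. real (count_nonnull m) / real m) \<longlonglongrightarrow> \<gamma>"
    and K: "(\<lambda>m. real (count_outer m) / real m) \<longlonglongrightarrow> \<gamma> + \<beta>"
    unfolding count_nonnull_def count_outer_def
    using fractions by (intro nat_floor_fraction_tendsto; simp)+
  show "(\<lambda>m. real (card (nonnulls m)) / real m) \<longlonglongrightarrow> \<gamma>"
    using H by (simp add: nonnulls_def)
  have "(\<lambda>m. real (count_outer m) / real m - real (count_nonnull m) / real m) \<longlonglongrightarrow> (\<gamma> + \<beta>) - \<gamma>"
    by (intro tendsto_diff H K)
  then show "(\<lambda>m. real (card (small m)) / real m) \<longlonglongrightarrow> \<beta>"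
    using count_bounds(1) by (simp add: small_def of_nat_diff diff_divide_distrib)
  have "(\<lambda>m. 1 - real (count_outer m) / real m) \<longlonglongrightarrow> 1 - (\<gamma> + \<beta>)"
    by (intro tendsto_diff K tendsto_const)
  moreover have "\<forall>\<^sub>F m in sequentially. 1 - real (count_outer m) / real m = real (card (large m)) / real m"
    using eventually_gt_at_top[of 0]
    by eventually_elim (use count_bounds(2) in \<open>simp add: large_def of_nat_diff diff_divide_distrib\<close>)
  ultimately have "(\<lambda>m. real (card (large m)) / real m) \<longlonglongrightarrow> 1 - (\<gamma> + \<beta>)"
    by (rule Lim_transform_eventually)
  then show "(\<lambda>m. real (card (large m)) / real m) \<longlonglongrightarrow> \<alpha>" by (simp add: algebra_simps)
qed

lemma abs_loading: "\<bar>loading m i\<bar> \<le> c" "\<bar>loading m i\<bar> < 1"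
  using loadings by (auto simp: loading_def)

lemma score_nonnull: "i \<in> nonnulls m \<Longrightarrow> score (signal m) (loading m) i \<omega> = \<mu> + \<omega> i"
  by (simp add: score_def signal_def loading_def nonnulls_def)

lemma score_small: "i \<in> small m \<Longrightarrow> score (signal m) (loading m) i \<omega> = - b * \<omega> 0 + r * \<omega> i"
  by (simp add: score_def signal_def loading_def small_def)

lemma score_large: "i \<in> large m \<Longrightarrow> score (signal m) (loading m) i \<omega> = c * \<omega> 0 + s * \<omega> i"
  using count_bounds(1)[of m] by (simp add: score_def signal_def loading_def large_def)

section \<open>The event of typical factor and typical counts\<close>

definition close :: "real \<Rightarrow> nat \<Rightarrow> nat set \<Rightarrow> real \<Rightarrow> real set \<Rightarrow> (nat \<Rightarrow> real) \<Rightarrow> bool" where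
  "close \<epsilon> m I \<kappa> S \<omega> \<longleftrightarrow>
     \<bar>real (card {i\<in>I. \<omega> i \<in> S}) - \<kappa> * measure gauss S * real m\<bar> < \<epsilon> * real m"

text \<open>The tail sets come from freezing the factor \<open>\<omega> 0\<close> at \<delta> (the
  first two), at -\<delta> (the next two) and at -\<open>B\<close> (the fifth); the last concerns
  the nonnulls, which have no factor. Both signs are covered by one event, so the law of the counts
  is never conditioned on the factor.\<close>

definition good :: "real \<Rightarrow> nat \<Rightarrow> (nat \<Rightarrow> real) \<Rightarrow> bool" where
  "good \<epsilon> m \<omega> \<longleftrightarrow> \<delta> \<le> \<bar>\<omega> 0\<bar> \<and> \<bar>\<omega> 0\<bar> \<le> B \<and>
     close \<epsilon> m (large m) \<alpha> {(t\<^sub>1 - c * \<delta>) / s..} \<omega> \<and>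
     close \<epsilon> m (large m) \<alpha> {..- ((t\<^sub>1 + c * \<delta>) / s)} \<omega> \<and>
     close \<epsilon> m (small m) \<beta> {(t\<^sub>2 - b * \<delta>) / r..} \<omega> \<and>
     close \<epsilon> m (small m) \<beta> {..- ((t\<^sub>2 + b * \<delta>) / r)} \<omega> \<and>
     close \<epsilon> m (large m) \<alpha> {..- ((t\<^sub>2 - c * B) / s)} \<omega> \<and>
     close \<epsilon> m (nonnulls m) \<gamma> {t\<^sub>0 - \<mu>..} \<omega>"

lemma prob_not_close_tendsto:
  assumes "S \<in> sets borel" "\<And>m. I m \<subseteq> {1..m}" "(\<lambda>m. real (card (I m)) / real m) \<longlonglongrightarrow> \<kappa>" "0 < \<epsilon>"
  shows "(\<lambda>m. noise.prob {\<omega>\<in>space noise. \<not> close \<epsilon> m (I m) \<kappa> S \<omega>}) \<longlonglongrightarrow> 0"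
  using noise_count_tendsto[OF assms] by (simp add: close_def not_less)

lemma measurable_close:
  assumes "finite I" "S \<in> sets borel"
  shows "Measurable.pred noise (close \<epsilon> m I \<kappa> S)"
proof -
  have eq: "real (card {i\<in>I. \<omega> i \<in> S}) = (\<Sum>i\<in>I. indicator S (\<omega> i))" for \<omega> :: "nat \<Rightarrow> real"
    using assms(1) by (simp add: indicator_def sum.If_cases Int_def)
  show ?thesis unfolding close_def eq using assms(2) by measurable
qed

lemma finite_blocks: "finite (nonnulls m)" "finite (small m)" "finite (large m)" "finite (nulls m)"
  by (auto simp: nonnulls_def small_def large_def nulls_def)

lemma sets_good: "{\<omega>\<in>space noise. good \<epsilon> m \<omega>} \<in> sets noise"
  unfolding good_def
  by (intro sets.sets_Collect_conj measurable_close[unfolded pred_def] finite_blocks; measurable)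

text \<open>A union bound: the factor is typical with probability above \<open>1 - \<eta>\<close> by
  a margin that does not depend on \<open>m\<close>, while the probabilities of the six deviation
  events tend to 0.\<close>

lemma eventually_prob_good:
  assumes "0 < \<epsilon>"
  shows "\<forall>\<^sub>F m in sequentially. 1 - \<eta> < noise.prob {\<omega>\<in>space noise. good \<epsilon> m \<omega>}"
proof -
  define Z where "Z = {\<omega>\<in>space noise. \<delta> \<le> \<bar>\<omega> 0\<bar> \<and> \<bar>\<omega> 0\<bar> \<le> B}"
  define bad where "bad I \<kappa> S m = {\<omega>\<in>space noise. \<not> close \<epsilon> m (I m) \<kappa> S \<omega>}" for I \<kappa> S m
  let ?E1 = "bad large \<alpha> {(t\<^sub>1 - c * \<delta>) / s..}"
  let ?E2 = "bad large \<alpha> {..- ((t\<^sub>1 + c * \<delta>) / s)}"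
  let ?E3 = "bad small \<beta> {(t\<^sub>2 - b * \<delta>) / r..}"
  let ?E4 = "bad small \<beta> {..- ((t\<^sub>2 + b * \<delta>) / r)}"
  let ?E5 = "bad large \<alpha> {..- ((t\<^sub>2 - c * B) / s)}"
  let ?E6 = "bad nonnulls \<gamma> {t\<^sub>0 - \<mu>..}"
  have meas: "Z \<in> sets noise" "bad large \<kappa> S m \<in> sets noise" "bad small \<kappa> S m \<in> sets noise"
      "bad nonnulls \<kappa> S m \<in> sets noise" if "S \<in> sets borel" for \<kappa> S m
    unfolding Z_def bad_def using that
    by (auto intro!: sets.sets_Collect_neg measurable_close[unfolded pred_def] finite_blocks)
  have lim: "(\<lambda>m. noise.prob (bad large \<alpha> S m)) \<longlonglongrightarrow> 0" "(\<lambda>m. noise.prob (bad small \<beta> S m)) \<longlonglongrightarrow> 0"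
      "(\<lambda>m. noise.prob (bad nonnulls \<gamma> S m)) \<longlonglongrightarrow> 0" if "S \<in> sets borel" for S
    unfolding bad_def using blocks_subset assms that
    by (intro prob_not_close_tendsto block_densities; blast)+
  have "(\<lambda>m. noise.prob Z - (noise.prob (?E1 m) + noise.prob (?E2 m) + noise.prob (?E3 m)
      + noise.prob (?E4 m) + noise.prob (?E5 m) + noise.prob (?E6 m))) \<longlonglongrightarrow> noise.prob Z - (0 + 0 + 0 + 0 + 0 + 0)"
    by (intro tendsto_diff tendsto_add tendsto_const lim) auto
  moreover have "1 - \<eta> < noise.prob Z - (0 + 0 + 0 + 0 + 0 + 0)"
  proof -
    have "noise.prob Z = measure (distr noise borel (\<lambda>\<omega>. \<omega> 0)) {x. \<delta> \<le> \<bar>x\<bar> \<and> \<bar>x\<bar> \<le> B}"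
      unfolding Z_def by (subst measure_distr) (auto intro!: arg_cong[where f=noise.prob])
    then show ?thesis using range(2) by (simp add: distr_noise_component)
  qed
  ultimately have "\<forall>\<^sub>F m in sequentially. 1 - \<eta> < noise.prob Z - (noise.prob (?E1 m) + noise.prob (?E2 m)
      + noise.prob (?E3 m) + noise.prob (?E4 m) + noise.prob (?E5 m) + noise.prob (?E6 m))"
    by (rule order_tendstoD(1))
  then show ?thesis
  proof eventually_elim
    case (elim m)
    let ?G = "{\<omega>\<in>space noise. good \<epsilon> m \<omega>}"
    have "noise.prob Z \<le> noise.prob (?G \<union> (?E1 m \<union> (?E2 m \<union> (?E3 m \<union> (?E4 m \<union> (?E5 m \<union> ?E6 m))))))"
    proof (rule noise.finite_measure_mono)
      show "?G \<union> (?E1 m \<union> (?E2 m \<union> (?E3 m \<union> (?E4 m \<union> (?E5 m \<union> ?E6 m))))) \<in> sets noise"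
        by (intro sets.Un sets_good meas) auto
    qed (auto simp: Z_def bad_def good_def)
    also have "\<dots> \<le> noise.prob ?G + (noise.prob (?E1 m) + (noise.prob (?E2 m) + (noise.prob (?E3 m)
      + (noise.prob (?E4 m) + (noise.prob (?E5 m) + noise.prob (?E6 m))))))"
      by (intro order_trans[OF measure_Un_le] add_left_mono order_refl sets.Un sets_good meas) auto
    finally show ?case using elim by linarith
  qed
qed

section \<open>Deterministic bounds on the false discovery proportion and the power\<close>

lemma rejection_bounds:
  assumes m: "1 \<le> \<gamma> * real m" and t: "0 < t" "t \<le> t\<^sub>0"
    and P: "P \<le> real (card {i\<in>nulls m. t \<le> w i})" and N: "real (card {i\<in>{1..m}. w i \<le> - t}) \<le> N"
    and reject: "1 + N \<le> q * P" and few: "\<gamma> * real m \<le> \<eta> * P"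
    and strong: "(1 - \<eta>) * (\<gamma> * real m) \<le> real (card {i\<in>nonnulls m. t\<^sub>0 \<le> w i})"
  shows "1 - \<eta> \<le> real (card (knockoff_rejections q m w \<inter> nulls m)) / real (max (card (knockoff_rejections q m w)) 1)"
    and "1 - \<eta> \<le> real (card (knockoff_rejections q m w \<inter> nonnulls m)) / real (card (nonnulls m))"
proof -
  let ?R = "knockoff_rejections q m w"
  have "0 \<le> N" using N of_nat_0_le_iff by (rule order_trans[rotated])
  then have "0 < q * P" using reject by linarith
  then have "0 < P" using q by (simp add: zero_less_mult_iff)
  then have V: "0 < card {i\<in>nulls m. t \<le> w i}" using P by linarith
  have mono: "card {i\<in>nulls m. t \<le> w i} \<le> N_plus m w t"
    unfolding N_plus_def using blocks_subset(2)[of m] by (intro card_mono) auto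
  have "q * P \<le> q * real (N_plus m w t)"
    using P mono q by (intro mult_left_mono) auto
  \<comment> \<open>The nulls above \<open>t\<close> alone already bring the knockoff+ ratio at
    \<open>t\<close> down to \<open>q\<close>, so everything above \<open>t\<close> is
    rejected.\<close>
  then have sub: "{i\<in>{1..m}. t \<le> w i} \<subseteq> ?R"
    using reject N V mono t by (intro knockoff_rejections_superset) (auto simp: N_minus_def)
  have R: "?R \<subseteq> {1..m}" by (auto simp: knockoff_rejections_def)
  have cH: "real (card (nonnulls m)) \<le> \<gamma> * real m" using count_bounds(3) by (simp add: nonnulls_def)
  have "\<eta> * P \<le> \<eta> * real (card {i\<in>nulls m. t \<le> w i})"
    using P \<eta> by (intro mult_left_mono) auto
  then have "real (card (nonnulls m)) \<le> \<eta> * real (card {i\<in>nulls m. t \<le> w i})"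
    using cH few by linarith
  then show "1 - \<eta> \<le> real (card (?R \<inter> nulls m)) / real (max (card ?R) 1)"
    by (intro fdp_ge[OF blocks_subset(2) nonnulls_eq R sub V])
  \<comment> \<open>At least one nonnull exists; otherwise the quotient would be 0 by the convention
    for division by zero.\<close>
  have "1 \<le> \<lfloor>\<gamma> * real m\<rfloor>" using m by (simp add: one_le_floor)
  then have pos: "0 < card (nonnulls m)" by (simp add: nonnulls_def count_nonnull_def)
  \<comment> \<open>\<open>t\<^sub>0\<close> is the larger of the two levels, so nonnulls above it
    are rejected whichever level applies.\<close>
  have "{i\<in>nonnulls m. t\<^sub>0 \<le> w i} \<subseteq> ?R \<inter> nonnulls m"
    using sub blocks_subset(1)[of m] t(2) by fastforce
  then have "card {i\<in>nonnulls m. t\<^sub>0 \<le> w i} \<le> card (?R \<inter> nonnulls m)"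
    using finite_blocks(1)[of m] by (intro card_mono) auto
  moreover have "(1 - \<eta>) * real (card (nonnulls m)) \<le> (1 - \<eta>) * (\<gamma> * real m)"
    using cH \<eta> by (intro mult_left_mono) auto
  ultimately have "(1 - \<eta>) * real (card (nonnulls m)) \<le> real (card (?R \<inter> nonnulls m))"
    using strong by linarith
  then show "1 - \<eta> \<le> real (card (?R \<inter> nonnulls m)) / real (card (nonnulls m))"
    using pos by (simp add: le_divide_eq)
qed

text \<open>Strict inequalities survive a small perturbation, and five of them share one \<epsilon>.
  On the left, one \<epsilon> pays for each lower-tail count estimated by the law of large numbers
  (one at \<open>t\<^sub>1\<close>, two at \<open>t\<^sub>2\<close>) and one more for the
  \<open>1 +\<close> of knockoff+.\<close>

lemma slack_exists:
  obtains \<epsilon> where "0 < \<epsilon>"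
    "\<gamma> + \<beta> + \<alpha> * upper_tail ((t\<^sub>1 + c * \<delta>) / s) + 2 * \<epsilon> \<le> q * (\<alpha> * upper_tail ((t\<^sub>1 - c * \<delta>) / s) - \<epsilon>)"
    "\<gamma> + \<beta> * upper_tail ((t\<^sub>2 + b * \<delta>) / r) + \<alpha> * upper_tail ((t\<^sub>2 - c * B) / s) + 3 * \<epsilon>
       \<le> q * (\<beta> * upper_tail ((t\<^sub>2 - b * \<delta>) / r) - \<epsilon>)"
    "\<gamma> \<le> \<eta> * (\<alpha> * upper_tail ((t\<^sub>1 - c * \<delta>) / s) - \<epsilon>)"
    "\<gamma> \<le> \<eta> * (\<beta> * upper_tail ((t\<^sub>2 - b * \<delta>) / r) - \<epsilon>)"
    "(1 - \<eta>) * \<gamma> \<le> \<gamma> * upper_tail (t\<^sub>0 - \<mu>) - \<epsilon>"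
proof -
  have slack: "\<forall>\<^sub>F \<epsilon> in at_right 0. x + k * \<epsilon> \<le> u * (y - \<epsilon>)" if "x < u * y" for x k u y :: real
  proof -
    have "((\<lambda>\<epsilon>. u * (y - \<epsilon>) - (x + k * \<epsilon>)) \<longlongrightarrow> u * (y - 0) - (x + k * 0)) (at_right 0)"
      by (intro tendsto_intros)
    then have "\<forall>\<^sub>F \<epsilon> in at_right 0. 0 < u * (y - \<epsilon>) - (x + k * \<epsilon>)"
      by (rule order_tendstoD(1)) (use that in simp)
    then show ?thesis by eventually_elim simp
  qed
  have "(1 - \<eta>) * \<gamma> < 1 * (\<gamma> * upper_tail (t\<^sub>0 - \<mu>))"
    using mult_strict_left_mono[OF strong_signal fractions(2)] by (simp add: mult_ac)
  from eventually_conj[OF slack[OF large_block, of 2] eventually_conj[OF slack[OF small_block, of 3]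
     eventually_conj[OF slack[OF few_nonnulls(1), of 0] eventually_conj[OF slack[OF few_nonnulls(2), of 0]
     eventually_conj[OF slack[OF this, of 0] eventually_at_right_less]]]]]
  show thesis
    by (auto dest!: eventually_happens intro: that)
qed

text \<open>The sign of \<open>\<omega> 0\<close> selects the level, and monotonicity of the scores
  in the factor reduces the counts to those recorded in \<open>good\<close>. As \<open>w\<close>
  need only match the scores on \<open>{1..m}\<close>, the bounds transfer to
  \<open>nonzero_score\<close> at almost every sample point.\<close>

lemma good_bounds:
  assumes \<epsilon>: "0 < \<epsilon>"
    and slack1: "\<gamma> + \<beta> + \<alpha> * upper_tail ((t\<^sub>1 + c * \<delta>) / s) + 2 * \<epsilon> \<le> q * (\<alpha> * upper_tail ((t\<^sub>1 - c * \<delta>) / s) - \<epsilon>)"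
    and slack2: "\<gamma> + \<beta> * upper_tail ((t\<^sub>2 + b * \<delta>) / r) + \<alpha> * upper_tail ((t\<^sub>2 - c * B) / s) + 3 * \<epsilon>
       \<le> q * (\<beta> * upper_tail ((t\<^sub>2 - b * \<delta>) / r) - \<epsilon>)"
    and few1: "\<gamma> \<le> \<eta> * (\<alpha> * upper_tail ((t\<^sub>1 - c * \<delta>) / s) - \<epsilon>)"
    and few2: "\<gamma> \<le> \<eta> * (\<beta> * upper_tail ((t\<^sub>2 - b * \<delta>) / r) - \<epsilon>)"
    and strong: "(1 - \<eta>) * \<gamma> \<le> \<gamma> * upper_tail (t\<^sub>0 - \<mu>) - \<epsilon>"
    and m: "1 \<le> \<epsilon> * real m" "1 \<le> \<gamma> * real m"
    and good: "good \<epsilon> m \<omega>" and w: "\<And>i. i \<in> {1..m} \<Longrightarrow> w i = score (signal m) (loading m) i \<omega>"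
  shows "1 - \<eta> \<le> real (card (knockoff_rejections q m w \<inter> nulls m)) / real (max (card (knockoff_rejections q m w)) 1)
       \<and> 1 - \<eta> \<le> real (card (knockoff_rejections q m w \<inter> nonnulls m)) / real (card (nonnulls m))"
proof -
  define M where "M = real m"
  have M: "0 \<le> M" by (simp add: M_def)
  have w_block: "i \<in> nonnulls m \<Longrightarrow> w i = \<mu> + \<omega> i" "i \<in> small m \<Longrightarrow> w i = - b * \<omega> 0 + r * \<omega> i"
    "i \<in> large m \<Longrightarrow> w i = c * \<omega> 0 + s * \<omega> i" for i
    using blocks_subset[of m] w score_nonnull score_small score_large by (metis subsetD)+
  have cnt: "real (card {i\<in>large m. (t\<^sub>1 - c * \<delta>) / s \<le> \<omega> i}) \<ge> (\<alpha> * upper_tail ((t\<^sub>1 - c * \<delta>) / s) - \<epsilon>) * M"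
    "real (card {i\<in>large m. \<omega> i \<le> - ((t\<^sub>1 + c * \<delta>) / s)}) \<le> (\<alpha> * upper_tail ((t\<^sub>1 + c * \<delta>) / s) + \<epsilon>) * M"
    "real (card {i\<in>small m. (t\<^sub>2 - b * \<delta>) / r \<le> \<omega> i}) \<ge> (\<beta> * upper_tail ((t\<^sub>2 - b * \<delta>) / r) - \<epsilon>) * M"
    "real (card {i\<in>small m. \<omega> i \<le> - ((t\<^sub>2 + b * \<delta>) / r)}) \<le> (\<beta> * upper_tail ((t\<^sub>2 + b * \<delta>) / r) + \<epsilon>) * M"
    "real (card {i\<in>large m. \<omega> i \<le> - ((t\<^sub>2 - c * B) / s)}) \<le> (\<alpha> * upper_tail ((t\<^sub>2 - c * B) / s) + \<epsilon>) * M"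
    "real (card {i\<in>nonnulls m. t\<^sub>0 - \<mu> \<le> \<omega> i}) \<ge> (\<gamma> * upper_tail (t\<^sub>0 - \<mu>) - \<epsilon>) * M"
    using good unfolding good_def close_def measure_gauss_atMost upper_tail_def[symmetric] M_def[symmetric] minus_minus
      atLeast_iff atMost_iff left_diff_distrib distrib_right abs_less_iff by linarith+
  have "{i\<in>nonnulls m. t\<^sub>0 \<le> w i} = {i\<in>nonnulls m. t\<^sub>0 - \<mu> \<le> \<omega> i}"
    using w_block(1) by force
  moreover have "(1 - \<eta>) * (\<gamma> * M) \<le> (\<gamma> * upper_tail (t\<^sub>0 - \<mu>) - \<epsilon>) * M"
    using mult_right_mono[OF strong M] by (simp add: mult_ac)
  ultimately have power: "(1 - \<eta>) * (\<gamma> * real m) \<le> real (card {i\<in>nonnulls m. t\<^sub>0 \<le> w i})"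
    using cnt(6) unfolding M_def by (simp only:)
  have split: "{1..m} = nonnulls m \<union> small m \<union> large m"
    using count_bounds(1,2)[of m] by (auto simp: nonnulls_def small_def large_def)
  consider "\<delta> \<le> \<omega> 0" | "\<delta> \<le> - \<omega> 0" "- \<omega> 0 \<le> B" using good unfolding good_def by linarith
  then show ?thesis
  proof cases
    case 1
    have c\<delta>: "c * \<delta> \<le> c * \<omega> 0" using 1 loadings by (intro mult_left_mono) auto
    have "card {i\<in>large m. (t\<^sub>1 - c * \<delta>) / s \<le> \<omega> i} \<le> card {i\<in>nulls m. t\<^sub>1 \<le> w i}"
    proof (rule card_mono)
      show "{i\<in>large m. (t\<^sub>1 - c * \<delta>) / s \<le> \<omega> i} \<subseteq> {i\<in>nulls m. t\<^sub>1 \<le> w i}"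
        using c\<delta> w_block(3) blocks_subset(4)[of m] noise_levels_pos(1) by (auto simp: divide_le_eq mult.commute)
    qed (simp add: finite_blocks)
    then have P: "(\<alpha> * upper_tail ((t\<^sub>1 - c * \<delta>) / s) - \<epsilon>) * M \<le> real (card {i\<in>nulls m. t\<^sub>1 \<le> w i})"
      using cnt(1) by linarith
    \<comment> \<open>Nonnulls and small block are conceded entirely to the lower tail, which is the
      term \<open>\<gamma> + \<beta>\<close> of \<open>large_block\<close>.\<close>
    have "{i\<in>{1..m}. w i \<le> - t\<^sub>1} \<subseteq> {1..count_outer m} \<union> {i\<in>large m. \<omega> i \<le> - ((t\<^sub>1 + c * \<delta>) / s)}"
    proof
      fix i assume i: "i \<in> {i\<in>{1..m}. w i \<le> - t\<^sub>1}"
      show "i \<in> {1..count_outer m} \<union> {i\<in>large m. \<omega> i \<le> - ((t\<^sub>1 + c * \<delta>) / s)}"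
      proof (cases "i \<in> large m")
        case True
        then have "s * \<omega> i \<le> - (t\<^sub>1 + c * \<delta>)" using i w_block(3)[of i] c\<delta> by auto
        then have "\<omega> i \<le> - ((t\<^sub>1 + c * \<delta>) / s)"
          using noise_levels_pos(1) by (simp only: pos_le_minus_divide_eq mult.commute)
        with True show ?thesis by blast
      qed (use i in \<open>auto simp: large_def\<close>)
    qed
    then have "card {i\<in>{1..m}. w i \<le> - t\<^sub>1} \<le> card ({1..count_outer m} \<union> {i\<in>large m. \<omega> i \<le> - ((t\<^sub>1 + c * \<delta>) / s)})"
      by (intro card_mono) (auto simp: finite_blocks)
    also have "\<dots> \<le> card {1..count_outer m} + card {i\<in>large m. \<omega> i \<le> - ((t\<^sub>1 + c * \<delta>) / s)}"
      by (rule card_Un_le)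
    finally have "real (card {i\<in>{1..m}. w i \<le> - t\<^sub>1})
        \<le> real (count_outer m) + real (card {i\<in>large m. \<omega> i \<le> - ((t\<^sub>1 + c * \<delta>) / s)})" by simp
    also have "\<dots> \<le> (\<gamma> + \<beta>) * M + (\<alpha> * upper_tail ((t\<^sub>1 + c * \<delta>) / s) + \<epsilon>) * M"
      using count_bounds(4)[of m] cnt(2) unfolding M_def by (rule add_mono)
    finally have N: "real (card {i\<in>{1..m}. w i \<le> - t\<^sub>1})
      \<le> (\<gamma> + \<beta> + \<alpha> * upper_tail ((t\<^sub>1 + c * \<delta>) / s) + \<epsilon>) * M" by (simp add: algebra_simps)
    \<comment> \<open>For large \<open>m\<close> the \<open>1 +\<close> of knockoff+ fits into one
      further \<epsilon>.\<close>
    have "1 + (\<gamma> + \<beta> + \<alpha> * upper_tail ((t\<^sub>1 + c * \<delta>) / s) + \<epsilon>) * M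
        \<le> (\<gamma> + \<beta> + \<alpha> * upper_tail ((t\<^sub>1 + c * \<delta>) / s) + 2 * \<epsilon>) * M"
      using m(1) by (simp add: M_def algebra_simps)
    also have "\<dots> \<le> q * ((\<alpha> * upper_tail ((t\<^sub>1 - c * \<delta>) / s) - \<epsilon>) * M)"
      using mult_right_mono[OF slack1 M] by (simp only: mult.assoc)
    finally have reject: "1 + (\<gamma> + \<beta> + \<alpha> * upper_tail ((t\<^sub>1 + c * \<delta>) / s) + \<epsilon>) * M
        \<le> q * ((\<alpha> * upper_tail ((t\<^sub>1 - c * \<delta>) / s) - \<epsilon>) * M)" .
    have few: "\<gamma> * real m \<le> \<eta> * ((\<alpha> * upper_tail ((t\<^sub>1 - c * \<delta>) / s) - \<epsilon>) * M)"
      using mult_right_mono[OF few1 M] by (simp only: mult.assoc M_def)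
    show ?thesis
      using rejection_bounds[OF m(2) thresholds(1) _ P N reject few power] by simp
  next
    case 2
    \<comment> \<open>For a negative factor the small block moves right by at least
      \<open>b * \<delta>\<close>, while the large block moves left by at most
      \<open>c * B\<close>.\<close>
    have b\<delta>: "b * \<delta> \<le> - b * \<omega> 0" using mult_left_mono[OF 2(1), of b] loadings by simp
    have cB: "- (c * B) \<le> c * \<omega> 0" using mult_left_mono[OF 2(2), of c] loadings by simp
    have "card {i\<in>small m. (t\<^sub>2 - b * \<delta>) / r \<le> \<omega> i} \<le> card {i\<in>nulls m. t\<^sub>2 \<le> w i}"
    proof (rule card_mono)
      show "{i\<in>small m. (t\<^sub>2 - b * \<delta>) / r \<le> \<omega> i} \<subseteq> {i\<in>nulls m. t\<^sub>2 \<le> w i}"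
        using b\<delta> w_block(2) blocks_subset(3)[of m] noise_levels_pos(2) by (auto simp: divide_le_eq mult.commute)
    qed (simp add: finite_blocks)
    then have P: "(\<beta> * upper_tail ((t\<^sub>2 - b * \<delta>) / r) - \<epsilon>) * M \<le> real (card {i\<in>nulls m. t\<^sub>2 \<le> w i})"
      using cnt(3) by linarith
    let ?S = "{i\<in>small m. \<omega> i \<le> - ((t\<^sub>2 + b * \<delta>) / r)}" and ?L = "{i\<in>large m. \<omega> i \<le> - ((t\<^sub>2 - c * B) / s)}"
    \<comment> \<open>Only the nonnulls are conceded in full here. Conceding the small block as well
      would cost \<beta>, more than \<open>q\<close> times its own upper tail.\<close>
    have "{i\<in>{1..m}. w i \<le> - t\<^sub>2} \<subseteq> nonnulls m \<union> (?S \<union> ?L)"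
    proof
      fix i assume i: "i \<in> {i\<in>{1..m}. w i \<le> - t\<^sub>2}"
      then consider "i \<in> nonnulls m" | "i \<in> small m" | "i \<in> large m" using split by blast
      then show "i \<in> nonnulls m \<union> (?S \<union> ?L)"
      proof cases
        case 2
        then have "r * \<omega> i \<le> - (t\<^sub>2 + b * \<delta>)" using i w_block(2)[of i] b\<delta> by auto
        then have "\<omega> i \<le> - ((t\<^sub>2 + b * \<delta>) / r)"
          using noise_levels_pos(2) by (simp only: pos_le_minus_divide_eq mult.commute)
        with 2 show ?thesis by blast
      next
        case 3
        then have "s * \<omega> i \<le> - (t\<^sub>2 - c * B)" using i w_block(3)[of i] cB by auto
        then have "\<omega> i \<le> - ((t\<^sub>2 - c * B) / s)"
          using noise_levels_pos(1) by (simp only: pos_le_minus_divide_eq mult.commute)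
        with 3 show ?thesis by blast
      qed blast
    qed
    then have "card {i\<in>{1..m}. w i \<le> - t\<^sub>2} \<le> card (nonnulls m \<union> (?S \<union> ?L))"
      by (intro card_mono) (auto simp: finite_blocks)
    also have "\<dots> \<le> card (nonnulls m) + (card ?S + card ?L)"
      using card_Un_le[of "nonnulls m" "?S \<union> ?L"] card_Un_le[of ?S ?L] by linarith
    finally have "real (card {i\<in>{1..m}. w i \<le> - t\<^sub>2}) \<le> real (count_nonnull m) + (real (card ?S) + real (card ?L))"
      by (simp add: nonnulls_def)
    also have "\<dots> \<le> \<gamma> * M + ((\<beta> * upper_tail ((t\<^sub>2 + b * \<delta>) / r) + \<epsilon>) * M + (\<alpha> * upper_tail ((t\<^sub>2 - c * B) / s) + \<epsilon>) * M)"
      using count_bounds(3)[of m] cnt(4,5) unfolding M_def by (intro add_mono)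
    finally have N: "real (card {i\<in>{1..m}. w i \<le> - t\<^sub>2})
      \<le> (\<gamma> + \<beta> * upper_tail ((t\<^sub>2 + b * \<delta>) / r) + \<alpha> * upper_tail ((t\<^sub>2 - c * B) / s) + 2 * \<epsilon>) * M"
      by (simp add: algebra_simps)
    have "1 + (\<gamma> + \<beta> * upper_tail ((t\<^sub>2 + b * \<delta>) / r) + \<alpha> * upper_tail ((t\<^sub>2 - c * B) / s) + 2 * \<epsilon>) * M
        \<le> (\<gamma> + \<beta> * upper_tail ((t\<^sub>2 + b * \<delta>) / r) + \<alpha> * upper_tail ((t\<^sub>2 - c * B) / s) + 3 * \<epsilon>) * M"
      using m(1) by (simp add: M_def algebra_simps)
    also have "\<dots> \<le> q * ((\<beta> * upper_tail ((t\<^sub>2 - b * \<delta>) / r) - \<epsilon>) * M)"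
      using mult_right_mono[OF slack2 M] by (simp only: mult.assoc)
    finally have reject: "1 + (\<gamma> + \<beta> * upper_tail ((t\<^sub>2 + b * \<delta>) / r) + \<alpha> * upper_tail ((t\<^sub>2 - c * B) / s) + 2 * \<epsilon>) * M
        \<le> q * ((\<beta> * upper_tail ((t\<^sub>2 - b * \<delta>) / r) - \<epsilon>) * M)" .
    have few: "\<gamma> * real m \<le> \<eta> * ((\<beta> * upper_tail ((t\<^sub>2 - b * \<delta>) / r) - \<epsilon>) * M)"
      using mult_right_mono[OF few2 M] by (simp only: mult.assoc M_def)
    show ?thesis
      using rejection_bounds[OF m(2) thresholds(2) _ P N reject few power] by simp
  qed
qed

text \<open>One factor \<open>1 - \<eta>\<close> is the pointwise bound on the good event, the other
  bounds the probability of that event.\<close>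

lemma eventually_FDR_Power_ge:
  "\<forall>\<^sub>F m in sequentially.
     (1 - \<eta>)\<^sup>2 \<le> FDR noise (\<lambda>\<omega>. knockoff_rejections q m (\<lambda>i. nonzero_score (signal m) (loading m) i \<omega>)) (nulls m)
   \<and> (1 - \<eta>)\<^sup>2 \<le> Power noise (\<lambda>\<omega>. knockoff_rejections q m (\<lambda>i. nonzero_score (signal m) (loading m) i \<omega>)) (nonnulls m)"
proof -
  obtain \<epsilon> where \<epsilon>: "0 < \<epsilon>" and bounds: "\<And>m \<omega> w. 1 \<le> \<epsilon> * real m \<Longrightarrow> 1 \<le> \<gamma> * real m \<Longrightarrow> good \<epsilon> m \<omega> \<Longrightarrow>
      (\<And>i. i \<in> {1..m} \<Longrightarrow> w i = score (signal m) (loading m) i \<omega>) \<Longrightarrow>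
      1 - \<eta> \<le> real (card (knockoff_rejections q m w \<inter> nulls m)) / real (max (card (knockoff_rejections q m w)) 1)
       \<and> 1 - \<eta> \<le> real (card (knockoff_rejections q m w \<inter> nonnulls m)) / real (card (nonnulls m))"
    by (rule slack_exists) (rule that, assumption, rule good_bounds)
  have "\<forall>\<^sub>F m in sequentially. 1 \<le> \<epsilon> * real m" "\<forall>\<^sub>F m in sequentially. 1 \<le> \<gamma> * real m"
    using \<epsilon> fractions by real_asymp+
  with eventually_prob_good[OF \<epsilon>] show ?thesis
  proof eventually_elim
    case (elim m)
    let ?R = "\<lambda>\<omega>. knockoff_rejections q m (\<lambda>i. nonzero_score (signal m) (loading m) i \<omega>)"
    define G where "G = {\<omega>\<in>space noise. good \<epsilon> m \<omega>}"
    have G: "G \<in> sets noise" unfolding G_def by (rule sets_good)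
    have AE: "AE \<omega> in noise. \<forall>i\<in>{1..m}. nonzero_score (signal m) (loading m) i \<omega> = score (signal m) (loading m) i \<omega>"
      by (rule AE_nonzero_score_all) (rule abs_loading)
    have card: "(\<lambda>\<omega>. real (card (?R \<omega> \<inter> H))) \<in> borel_measurable noise" for H
      by (rule measurable_compose[OF measurable_card_knockoff_rejections]) simp_all
    have fin: "finite (?R \<omega>)" for \<omega> unfolding knockoff_rejections_def by simp
    have le1: "real (card (?R \<omega> \<inter> nulls m)) / real (max (card (?R \<omega>)) 1) \<le> 1"
        "real (card (?R \<omega> \<inter> nonnulls m)) / real (card (nonnulls m)) \<le> 1" for \<omega>
      using card_mono[OF fin, of "?R \<omega> \<inter> nulls m" \<omega>] card_mono[OF finite_blocks(1)[of m], of "?R \<omega> \<inter> nonnulls m"]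
      by (auto simp: divide_le_eq_1)
    have "(1 - \<eta>)\<^sup>2 \<le> (1 - \<eta>) * noise.prob G"
      using elim(1) \<eta> unfolding G_def power2_eq_square by (intro mult_left_mono) auto
    moreover have "(1 - \<eta>) * noise.prob G \<le> FDR noise ?R (nulls m)"
      unfolding FDR_def
    proof (rule expectation_ge_on_event[OF noise.prob_space_axioms _ G _ le1(1)])
      show "(\<lambda>\<omega>. real (card (?R \<omega> \<inter> nulls m)) / real (max (card (?R \<omega>)) 1)) \<in> borel_measurable noise"
        unfolding of_nat_max using card[of UNIV]
        by (intro borel_measurable_divide borel_measurable_max card borel_measurable_const) simp
      show "AE \<omega> in noise. \<omega> \<in> G \<longrightarrow> 1 - \<eta> \<le> real (card (?R \<omega> \<inter> nulls m)) / real (max (card (?R \<omega>)) 1)"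
        using AE
      proof eventually_elim
        fix \<omega>
        assume "\<forall>i\<in>{1..m}. nonzero_score (signal m) (loading m) i \<omega> = score (signal m) (loading m) i \<omega>"
        then show "\<omega> \<in> G \<longrightarrow> 1 - \<eta> \<le> real (card (?R \<omega> \<inter> nulls m)) / real (max (card (?R \<omega>)) 1)"
          using bounds[OF elim(2,3), of \<omega> "\<lambda>i. nonzero_score (signal m) (loading m) i \<omega>"] by (simp add: G_def)
      qed
    qed simp_all
    moreover have "(1 - \<eta>) * noise.prob G \<le> Power noise ?R (nonnulls m)"
      unfolding Power_def
    proof (rule expectation_ge_on_event[OF noise.prob_space_axioms _ G _ le1(2)])
      show "(\<lambda>\<omega>. real (card (?R \<omega> \<inter> nonnulls m)) / real (card (nonnulls m))) \<in> borel_measurable noise"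
        by (intro borel_measurable_divide card borel_measurable_const)
      show "AE \<omega> in noise. \<omega> \<in> G \<longrightarrow> 1 - \<eta> \<le> real (card (?R \<omega> \<inter> nonnulls m)) / real (card (nonnulls m))"
        using AE
      proof eventually_elim
        fix \<omega>
        assume "\<forall>i\<in>{1..m}. nonzero_score (signal m) (loading m) i \<omega> = score (signal m) (loading m) i \<omega>"
        then show "\<omega> \<in> G \<longrightarrow> 1 - \<eta> \<le> real (card (?R \<omega> \<inter> nonnulls m)) / real (card (nonnulls m))"
          using bounds[OF elim(2,3), of \<omega> "\<lambda>i. nonzero_score (signal m) (loading m) i \<omega>"] by (simp add: G_def)
      qed
    qed simp_all
    ultimately show ?case by linarith
  qed
qed

end

theorem theorem3:
  fixes q \<rho> \<eta> :: real
  assumes "0 < q" "q < 1"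
    and "0 < \<rho>" "\<rho> < 1"
    and "0 < \<eta>"
  shows "\<exists>(\<mu>::real) (\<gamma>::real)
            (M :: nat \<Rightarrow> (nat \<Rightarrow> real) measure)
            (W :: nat \<Rightarrow> nat \<Rightarrow> (nat \<Rightarrow> real) \<Rightarrow> real)
            (H0 :: nat \<Rightarrow> nat set) (H1 :: nat \<Rightarrow> nat set).
     0 < \<mu> \<and> 0 < \<gamma> \<and> \<gamma> < 1 \<and>
     (\<forall>m\<ge>1.
        prob_space (M m) \<and>
        jointly_gaussian (M m) {1..m} (W m) \<and>
        H0 m \<subseteq> {1..m} \<and> H1 m = {1..m} - H0 m \<and>
        (\<forall>i\<in>H0 m. distributed (M m) lborel (W m i) (\<lambda>x. ennreal (std_normal_density x))) \<and>
        (\<forall>i\<in>H1 m. distributed (M m) lborel (W m i) (\<lambda>x. ennreal (normal_density \<mu> 1 x))) \<and>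
        pos_def_on {1..m} (\<lambda>i j. covariance (M m) (W m i) (W m j)) \<and>
        (\<forall>i\<in>{1..m}. \<forall>j\<in>{1..m}. i \<noteq> j \<longrightarrow> \<bar>correlation (M m) (W m i) (W m j)\<bar> < \<rho>)) \<and>
     (\<lambda>m. real (card (H1 m)) / real m) \<longlonglongrightarrow> \<gamma> \<and>
     liminf (\<lambda>m. ereal (FDR (M m) (\<lambda>\<omega>. knockoff_rejections q m (\<lambda>i. W m i \<omega>)) (H0 m)))
       > ereal (1 - \<eta>) \<and>
     liminf (\<lambda>m. ereal (Power (M m) (\<lambda>\<omega>. knockoff_rejections q m (\<lambda>i. W m i \<omega>)) (H1 m)))
       > ereal (1 - \<eta>) \<and>
     (\<forall>m\<ge>1.
        (\<forall>i\<in>H0 m. distr (M m) borel (\<lambda>\<omega>. 1 - \<Phi> (W m i \<omega>))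
                     = uniform_measure lborel {0<..<1}) \<and>
        (\<forall>i\<in>H1 m. stoch_smaller (distr (M m) borel (\<lambda>\<omega>. 1 - \<Phi> (W m i \<omega>)))
                     (uniform_measure lborel {0<..<1})) \<and>
        (\<forall>\<omega>\<in>space (M m). mirror_rejections q m (\<lambda>i. 1 - \<Phi> (W m i \<omega>))
                     = knockoff_rejections q m (\<lambda>i. W m i \<omega>)))"
proof -
  \<comment> \<open>The square of \<open>1 - \<eta>'\<close> is at least
    \<open>1 - 2 * \<eta>'\<close>, hence strictly above \<open>1 - \<eta>\<close>; the cap 1/2
    keeps \<eta>' below 1 for arbitrarily large \<eta>.\<close>
  define \<eta>' where "\<eta>' = min (\<eta> / 3) (1 / 2)"
  have \<eta>': "0 < \<eta>'" "\<eta>' < 1" "\<eta>' \<le> \<eta> / 3" using \<open>0 < \<eta>\<close> by (auto simp: \<eta>'_def)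
  \<comment> \<open>Correlations are products of two loadings, so they are bounded by
    \<open>c * c\<close>, which is below \<rho>; \<open>b < c\<close> makes the idiosyncratic
    variance of the small block the larger one.\<close>
  define c b where "c = \<rho> / 2" and "b = \<rho> / 4"
  have cb: "0 < b" "b < c" "c < 1" using assms by (auto simp: c_def b_def)
  obtain \<delta> B \<beta> \<gamma> t\<^sub>1 t\<^sub>2 \<mu> where "block_scores q \<eta>' c b \<delta> B \<beta> \<gamma> t\<^sub>1 t\<^sub>2 \<mu>"
    using block_scores_exist[OF assms(1,2) \<eta>'(1,2) cb] by blast
  then interpret block_scores q \<eta>' c b \<delta> B \<beta> \<gamma> t\<^sub>1 t\<^sub>2 \<mu> .
  define W where "W m = nonzero_score (signal m) (loading m)" for m
  have null: "distributed noise lborel (W m i) (\<lambda>x. ennreal (std_normal_density x))" if "i \<in> nulls m" for m i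
  proof -
    have "1 \<le> i" "signal m i = 0" using that by (auto simp: nulls_def signal_def)
    with distributed_nonzero_score[of i "loading m" "signal m", OF this(1) abs_loading(2)] show ?thesis
      unfolding W_def by simp
  qed
  have nonnull: "distributed noise lborel (W m i) (\<lambda>x. ennreal (normal_density \<mu> 1 x))"
    if "i \<in> nonnulls m" for m i
  proof -
    have "1 \<le> i" "signal m i = \<mu>" using that by (auto simp: nonnulls_def signal_def)
    with distributed_nonzero_score[of i "loading m" "signal m", OF this(1) abs_loading(2)] show ?thesis
      unfolding W_def by simp
  qed
  have corr: "\<bar>correlation noise (W m i) (W m j)\<bar> < \<rho>" if "i \<in> {1..m}" "j \<in> {1..m}" "i \<noteq> j" for m i j
  proof -
    have "\<bar>loading m i * loading m j\<bar> \<le> c * c"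
      unfolding abs_mult using abs_loading(1) cb by (intro mult_mono) auto
    also have "\<dots> < \<rho>" using assms(3,4) mult_strict_left_mono[of \<rho> 4 \<rho>] by (simp add: c_def)
    finally show ?thesis
      using correlation_nonzero_score[of i m j "loading m", OF that abs_loading(2)] by (simp add: W_def)
  qed
  have gap: "1 - \<eta> < (1 - \<eta>')\<^sup>2"
  proof -
    have "(1 - \<eta>')\<^sup>2 = 1 - 2 * \<eta>' + \<eta>'\<^sup>2" by (simp add: power2_eq_square algebra_simps)
    moreover have "0 \<le> \<eta>'\<^sup>2" by simp
    ultimately show ?thesis using \<eta>'(3) \<open>0 < \<eta>\<close> by linarith
  qed
  have limit: "ereal (1 - \<eta>) < liminf (\<lambda>m. ereal (f m))" if "\<forall>\<^sub>F m in sequentially. (1 - \<eta>')\<^sup>2 \<le> f m" for f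
  proof -
    have "ereal ((1 - \<eta>')\<^sup>2) \<le> liminf (\<lambda>m. ereal (f m))"
      using that by (intro Liminf_bounded) simp
    moreover have "ereal (1 - \<eta>) < ereal ((1 - \<eta>')\<^sup>2)" using gap by simp
    ultimately show ?thesis by (rule less_le_trans[rotated])
  qed
  have power_limits: "\<forall>\<^sub>F m in sequentially. (1 - \<eta>')\<^sup>2 \<le> FDR noise (\<lambda>\<omega>. knockoff_rejections q m (\<lambda>i. W m i \<omega>)) (nulls m)"
    "\<forall>\<^sub>F m in sequentially. (1 - \<eta>')\<^sup>2 \<le> Power noise (\<lambda>\<omega>. knockoff_rejections q m (\<lambda>i. W m i \<omega>)) (nonnulls m)"
    using eventually_FDR_Power_ge unfolding W_def eventually_conj_iff by simp_all
  have mirror: "mirror_rejections q m (\<lambda>i. 1 - \<Phi> (W m i \<omega>)) = knockoff_rejections q m (\<lambda>i. W m i \<omega>)" for m \<omega>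
    by (rule mirror_rejections_eq_knockoff_rejections) (simp add: W_def nonzero_score_def)
  have model: "prob_space noise \<and> jointly_gaussian noise {1..m} (W m) \<and>
      nulls m \<subseteq> {1..m} \<and> nonnulls m = {1..m} - nulls m \<and>
      (\<forall>i\<in>nulls m. distributed noise lborel (W m i) (\<lambda>x. ennreal (std_normal_density x))) \<and>
      (\<forall>i\<in>nonnulls m. distributed noise lborel (W m i) (\<lambda>x. ennreal (normal_density \<mu> 1 x))) \<and>
      pos_def_on {1..m} (\<lambda>i j. covariance noise (W m i) (W m j)) \<and>
      (\<forall>i\<in>{1..m}. \<forall>j\<in>{1..m}. i \<noteq> j \<longrightarrow> \<bar>correlation noise (W m i) (W m j)\<bar> < \<rho>)" for m
    unfolding W_def
    by (intro conjI ballI impI noise.prob_space_axioms jointly_gaussian_nonzero_score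
        pos_def_nonzero_score abs_loading(2) blocks_subset(2) nonnulls_eq
        null[unfolded W_def] nonnull[unfolded W_def] corr[unfolded W_def])
  have p_values: "(\<forall>i\<in>nulls m. distr noise borel (\<lambda>\<omega>. 1 - \<Phi> (W m i \<omega>)) = uniform_measure lborel {0<..<1}) \<and>
      (\<forall>i\<in>nonnulls m. stoch_smaller (distr noise borel (\<lambda>\<omega>. 1 - \<Phi> (W m i \<omega>)))
         (uniform_measure lborel {0<..<1})) \<and>
      (\<forall>\<omega>\<in>space noise. mirror_rejections q m (\<lambda>i. 1 - \<Phi> (W m i \<omega>))
         = knockoff_rejections q m (\<lambda>i. W m i \<omega>))" for m
    by (intro conjI ballI distr_one_minus_cdf_null[OF null] mirror
        stoch_smaller_one_minus_cdf[OF noise.prob_space_axioms nonnull less_imp_le[OF \<mu>]])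
  show ?thesis
  proof (rule exI[of _ \<mu>], rule exI[of _ \<gamma>], rule exI[of _ "\<lambda>_. noise"], rule exI[of _ W],
        rule exI[of _ nulls], rule exI[of _ nonnulls], intro conjI)
    show "0 < \<mu>" "0 < \<gamma>" "\<gamma> < 1" using \<mu> fractions by simp_all
  qed (rule block_densities(1) limit[OF power_limits(1)] limit[OF power_limits(2)] | intro allI impI, rule model p_values)+
qed

end
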